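(* Let $G=(V,E)$ be a finite graph (loops allowed, no multiple edges). Then the set of elements of $\mathbb{Z}V$ given by the edges of $G$ and by the exceptional pairs of $G$ is the unique minimal generating set of the monoid $(\overline{\mathbb{N}\mathcal{A}}_G,+)$.
   Context: $V=\{x_1,\dots,x_n\}$ and $\mathbb{Z}V$ is the free abelian group on $V$, embedded in $\mathbb{Q}V$. A subset $X\subseteq V$ is identified with its characteristic function $\sum_{x\in X}x\in\mathbb{Z}V$. An edge $\{x_i,x_j\}$ with $i\ne j$ is represented by $x_i+x_j\in\mathbb{Z}V$, and a loop at $x_i$ by $2x_i$. $\mathcal{A}_G\subset\mathbb{Z}V$ is the set of all elements representing edges (including loops). $\overline{\mathbb{N}\mathcal{A}}_G$ is the additive monoid of all elements of $\mathbb{Z}V$ that are both $\mathbb{Z}$-linear combinations of elements of $\mathcal{A}_G$ and linear combinations of elements of $\mathcal{A}_G$ with nonnegative rational coefficients. (It corresponds to the set of monomials in the integral closure of the algebra generated by the monomials $x_ix_j$, $x_i^2$ corresponding to the edges and loops of $G$.) A circuit is a closed path (no repeated vertices apart from the first equal to the last); it is odd if it has an odd number of edges, and a loop counts as an odd circuit of length $1$. An exceptional pair in $G$ is an induced subgraph $H$ of $G$ consisting of two vertex-disjoint odd circuits (either may be a loop) that lie in the same connected component of $G$; "induced" means that the only edges (including loops) of $G$ among the vertices of $H$ are the edges of the two circuits. The exceptional pair $H$ is regarded as the element of $\mathbb{Z}V$ that is the sum of the vertices of $H$. *)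

theory Defs
  imports "HOL-Algebra.Free_Abelian_Groups" "HOL.Hull"
begin

text \<open>A loop at \<open>x\<close> is the singleton edge \<open>{x} = {x, x}\<close>.\<close>

definition finite_graph :: "'a set \<Rightarrow> 'a set set \<Rightarrow> bool" where
  "finite_graph V E \<longleftrightarrow> finite V \<and> (\<forall>e\<in>E. e \<subseteq> V \<and> (card e = 1 \<or> card e = 2))"

definition walk_edges :: "'a list \<Rightarrow> 'a set list" where
  "walk_edges p = map2 (\<lambda>u v. {u, v}) p (tl p)"

definition walk :: "'a set set \<Rightarrow> 'a list \<Rightarrow> bool" where
  "walk E p \<longleftrightarrow> p \<noteq> [] \<and> set (walk_edges p) \<subseteq> E"

definition connected_by_walk :: "'a set set \<Rightarrow> 'a \<Rightarrow> 'a \<Rightarrow> bool" where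
  "connected_by_walk E u v \<longleftrightarrow> (\<exists>p. walk E p \<and> hd p = u \<and> last p = v)"

text \<open>Circuits are closed walks whose first vertex is repeated at the end; \<open>[x, x]\<close> is the
  circuit of length 1 given by a loop. Distinctness of the edges only excludes \<open>[x, y, x]\<close>, which
  runs twice through the same edge.\<close>

definition circuit :: "'a set set \<Rightarrow> 'a list \<Rightarrow> bool" where
  "circuit E p \<longleftrightarrow> walk E p \<and> walk_edges p \<noteq> [] \<and> hd p = last p
     \<and> distinct (tl p) \<and> distinct (walk_edges p)"

definition odd_circuit :: "'a set set \<Rightarrow> 'a list \<Rightarrow> bool" where
  "odd_circuit E p \<longleftrightarrow> circuit E p \<and> odd (length (walk_edges p))"

definition exceptional_pair :: "'a set set \<Rightarrow> 'a list \<Rightarrow> 'a list \<Rightarrow> bool" where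
  "exceptional_pair E p q \<longleftrightarrow> odd_circuit E p \<and> odd_circuit E q \<and> set p \<inter> set q = {}
     \<and> connected_by_walk E (hd p) (hd q)
     \<and> {e \<in> E. e \<subseteq> set p \<union> set q} = set (walk_edges p) \<union> set (walk_edges q)"

text \<open>For \<open>x = y\<close> the following is the element \<open>2x\<close> representing a loop.\<close>

definition edge_elements :: "'a set set \<Rightarrow> ('a \<Rightarrow>\<^sub>0 int) set" where
  "edge_elements E = {frag_of x + frag_of y | x y. {x, y} \<in> E}"

definition char_element :: "'a set \<Rightarrow> ('a \<Rightarrow>\<^sub>0 int)" where
  "char_element X = (\<Sum>x\<in>X. frag_of x)"

definition exceptional_elements :: "'a set set \<Rightarrow> ('a \<Rightarrow>\<^sub>0 int) set" where
  "exceptional_elements E = {char_element (set p \<union> set q) | p q. exceptional_pair E p q}"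

text \<open>Linear combinations over a set \<open>A\<close> that is meant to be finite. The identity over the
  rationals is stated coordinatewise, that is, after embedding into the rational vector space.\<close>

definition int_combination :: "('a \<Rightarrow>\<^sub>0 int) set \<Rightarrow> ('a \<Rightarrow>\<^sub>0 int) \<Rightarrow> bool" where
  "int_combination A f \<longleftrightarrow> (\<exists>c :: ('a \<Rightarrow>\<^sub>0 int) \<Rightarrow> int. f = (\<Sum>a\<in>A. frag_cmul (c a) a))"

definition nonneg_rat_combination :: "('a \<Rightarrow>\<^sub>0 int) set \<Rightarrow> ('a \<Rightarrow>\<^sub>0 int) \<Rightarrow> bool" where
  "nonneg_rat_combination A f \<longleftrightarrow> (\<exists>c :: ('a \<Rightarrow>\<^sub>0 int) \<Rightarrow> rat. (\<forall>a\<in>A. 0 \<le> c a)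
     \<and> (\<forall>v. of_int (Poly_Mapping.lookup f v) = (\<Sum>a\<in>A. c a * of_int (Poly_Mapping.lookup a v))))"

definition normal_monoid :: "'a set \<Rightarrow> 'a set set \<Rightarrow> ('a \<Rightarrow>\<^sub>0 int) set" where
  "normal_monoid V E = {f \<in> carrier (free_Abelian_group V).
     int_combination (edge_elements E) f \<and> nonneg_rat_combination (edge_elements E) f}"

definition add_submonoid :: "'b::comm_monoid_add set \<Rightarrow> bool" where
  "add_submonoid M \<longleftrightarrow> 0 \<in> M \<and> (\<forall>x\<in>M. \<forall>y\<in>M. x + y \<in> M)"

definition generates :: "'b::comm_monoid_add set \<Rightarrow> 'b set \<Rightarrow> bool" where
  "generates S M \<longleftrightarrow> add_submonoid hull S = M"

definition minimal_generating_set :: "'b::comm_monoid_add set \<Rightarrow> 'b set \<Rightarrow> bool" where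
  "minimal_generating_set S M \<longleftrightarrow> generates S M \<and> (\<forall>T. T \<subset> S \<longrightarrow> \<not> generates T M)"

end

(* The normal monoid consists of nonnegative vectors, so its unique minimal generating set is the set
   of its irreducible elements as soon as these generate. Edges are irreducible because all degrees
   are even; an exceptional pair is irreducible because on an odd circuit the equations
   "incident coefficients sum to 1" force every coefficient to be 1/2, so that a summand cannot split
   a circuit, and a single odd circuit has odd degree. Conversely, split off edges as long as
   possible. A nonnegative rational representation of the rest with minimal support then has
   a 2-regular support, so the rest is a sum of characteristic functions of disjoint circuits.
   Even circuits are sums of edges; by parity the odd ones can be paired inside the connected
   components, and a pair that is not exceptional has a chord or a connecting edge, along which
   it is reduced to a pair of fewer vertices plus edges. *)

theory Submission
  imports Defs
begin

subsection \<open>Submonoids and irreducible elements\<close>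

text \<open>The two conditions that define the monoid have separate tasks. The rational cone
  controls supports: at a vertex where an element has coefficient 0, no edge can carry weight, and a
  representation of minimal support is linearly independent. From the lattice only parities are
  extracted, of the sum of the coefficients over \<open>V\<close> or over a connected component.
  Conversely, an exceptional pair lies in the lattice because a walk joins its circuits and because
  an odd circuit puts twice each of its vertices into the lattice. That a minimal support is
  2-regular needs no structure theory of independent edge sets. Splitting off edges first forces all
  weights below 1; this rules out vertices of degree 1, and comparing the number of edges with the
  number of vertices does the rest.\<close>

lemma add_submonoid_hull: "add_submonoid (add_submonoid hull S)"
  by (rule hull_in) (auto simp: add_submonoid_def)

lemma hull_zero: "0 \<in> add_submonoid hull S"
  using add_submonoid_hull unfolding add_submonoid_def by blast

lemma hull_add: "x \<in> add_submonoid hull S \<Longrightarrow> y \<in> add_submonoid hull S \<Longrightarrow> x + y \<in> add_submonoid hull S"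
  using add_submonoid_hull[of S] unfolding add_submonoid_def by blast

text \<open>The elements for which one of the alternatives holds, together with 0, form a submonoid
  \<open>N\<close> that contains \<open>S\<close>: a sum of two nonzero members is of the second
  kind by construction.\<close>

lemma hull_cases:
  assumes "x \<in> add_submonoid hull S" "x \<noteq> 0"
  obtains "x \<in> S"
  | a b where "a \<in> add_submonoid hull S" "b \<in> add_submonoid hull S" "a \<noteq> 0" "b \<noteq> 0" "x = a + b"
proof -
  define N where "N = {x \<in> add_submonoid hull S. x = 0 \<or> x \<in> S \<or>
    (\<exists>a\<in>add_submonoid hull S. \<exists>b\<in>add_submonoid hull S. a \<noteq> 0 \<and> b \<noteq> 0 \<and> x = a + b)}"
  have "add_submonoid N"
    unfolding add_submonoid_def
  proof (intro conjI ballI)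
    show "0 \<in> N"
      by (simp add: N_def hull_zero)
    show "x + y \<in> N" if "x \<in> N" "y \<in> N" for x y
    proof (cases "x = 0 \<or> y = 0")
      case True
      with that show ?thesis by auto
    next
      case False
      with that show ?thesis unfolding N_def by (blast intro: hull_add)
    qed
  qed
  moreover have "S \<subseteq> N"
    by (auto simp: N_def hull_inc)
  ultimately have "x \<in> N"
    using assms(1) hull_minimal by blast
  with assms(2) that show thesis
    unfolding N_def by blast
qed

text \<open>An irreducible nonzero element cannot be produced from others, so it lies in every
  generating set. Excluding 0 matters because 0 satisfies the splitting condition whenever no two
  nonzero elements cancel, yet is always redundant as a generator.\<close>

lemma minimal_generating_set_unique:
  assumes gen: "generates S M"
    and irr: "\<forall>x\<in>S. \<forall>a\<in>M. \<forall>b\<in>M. x = a + b \<longrightarrow> a = 0 \<or> b = 0"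
    and nz: "0 \<notin> S"
  shows "minimal_generating_set S M" and "minimal_generating_set T M \<Longrightarrow> T = S"
proof -
  have sub: "S \<subseteq> T" if "generates T M" for T
  proof
    fix x assume x: "x \<in> S"
    then have "x \<in> add_submonoid hull T"
      using that gen hull_inc[of x S add_submonoid] unfolding generates_def by blast
    moreover have "x \<noteq> 0" using x nz by blast
    ultimately show "x \<in> T"
      using bspec[OF irr x] that unfolding generates_def by (metis hull_cases)
  qed
  then show "minimal_generating_set S M"
    using gen unfolding minimal_generating_set_def by blast
  show "T = S" if "minimal_generating_set T M"
    using that sub[of T] gen unfolding minimal_generating_set_def by blast
qed

subsection \<open>Edge elements and their integer combinations\<close>

lemma lookup_sum: "Poly_Mapping.lookup (sum f A) v = (\<Sum>a\<in>A. Poly_Mapping.lookup (f a) v)"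
  by (induction A rule: infinite_finite_induct) (auto simp: lookup_add)

lemma lookup_frag_of: "Poly_Mapping.lookup (frag_of x) v = (if v = x then 1 else 0)"
  by (auto simp: lookup_single when_def)

lemma lookup_char_element:
  "finite X \<Longrightarrow> Poly_Mapping.lookup (char_element X) v = (if v \<in> X then 1 else 0)"
  by (simp add: char_element_def lookup_sum lookup_frag_of)

lemma char_element_Un:
  "finite X \<Longrightarrow> finite Y \<Longrightarrow> X \<inter> Y = {} \<Longrightarrow> char_element (X \<union> Y) = char_element X + char_element Y"
  by (simp add: char_element_def sum.union_disjoint)

lemma char_element_set: "distinct xs \<Longrightarrow> char_element (set xs) = sum_list (map frag_of xs)"
  by (simp add: char_element_def sum_list_distinct_conv_sum_set)

text \<open>The coefficients at the four vertices determine both pairs. This makes edges and edge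
  elements interchangeable, loops included.\<close>

lemma frag_pair_eq_iff:
  "frag_of x + frag_of y = frag_of u + frag_of v \<longleftrightarrow> {x, y} = {u, v}"
proof
  assume eq: "frag_of x + frag_of y = frag_of u + frag_of v"
  have "(if w = x then 1 else 0) + (if w = y then 1 else 0)
      = (if w = u then 1 else 0) + (if w = v then 1 else (0::int))" for w
    using arg_cong[OF eq, of "\<lambda>f. Poly_Mapping.lookup f w"] by (simp add: lookup_add lookup_frag_of)
  from this[of x] this[of y] this[of u] this[of v] show "{x, y} = {u, v}"
    by (auto split: if_splits)
qed (auto simp: doubleton_eq_iff add.commute)

lemma edge_elements_iff: "frag_of x + frag_of y \<in> edge_elements E \<longleftrightarrow> {x, y} \<in> E"
  by (auto simp: edge_elements_def frag_pair_eq_iff)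

lemma finite_edge_elements:
  assumes "finite_graph V E"
  shows "finite (edge_elements E)"
proof -
  have "edge_elements E \<subseteq> (\<lambda>(x, y). frag_of x + frag_of y) ` (V \<times> V)"
    using assms by (fastforce simp: edge_elements_def finite_graph_def)
  then show ?thesis
    using assms finite_subset by (fastforce simp: finite_graph_def)
qed

lemma edge_elements_lookup_nonneg:
  "a \<in> edge_elements E \<Longrightarrow> 0 \<le> Poly_Mapping.lookup a v"
  by (auto simp: edge_elements_def lookup_add lookup_frag_of)

section \<open>Closure properties of the two kinds of linear combinations\<close>

lemma int_combination_inc:
  assumes "finite A" "a \<in> A"
  shows "int_combination A a"
proof -
  have "a = (\<Sum>b\<in>A. frag_cmul (if b = a then 1 else 0) b)"
    using assms by (simp add: if_distrib[of "\<lambda>c. frag_cmul c _"] sum.delta cong: if_cong)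
  then show ?thesis
    unfolding int_combination_def by (intro exI[of _ "\<lambda>b. if b = a then 1 else 0"])
qed

lemma int_combination_zero: "int_combination A 0"
  unfolding int_combination_def by (rule exI[of _ "\<lambda>_. 0"]) simp

lemma int_combination_cmul: "int_combination A f \<Longrightarrow> int_combination A (frag_cmul k f)"
  unfolding int_combination_def by (auto simp: frag_cmul_sum)

lemma int_combination_add:
  assumes "int_combination A f" "int_combination A g"
  shows "int_combination A (f + g)"
proof -
  obtain c d where "f = (\<Sum>a\<in>A. frag_cmul (c a) a)" "g = (\<Sum>a\<in>A. frag_cmul (d a) a)"
    using assms unfolding int_combination_def by blast
  then have "f + g = (\<Sum>a\<in>A. frag_cmul (c a + d a) a)"
    by (simp add: frag_cmul_distrib sum.distrib)
  then show ?thesis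
    unfolding int_combination_def by (intro exI[of _ "\<lambda>a. c a + d a"])
qed

lemma int_combination_diff:
  "int_combination A f \<Longrightarrow> int_combination A g \<Longrightarrow> int_combination A (f - g)"
  using int_combination_add[of A f "frag_cmul (-1) g"] int_combination_cmul[of A g "-1"] by simp

lemma int_combination_hull:
  assumes "finite A" "f \<in> add_submonoid hull A"
  shows "int_combination A f"
  using assms(2)
proof (rule hull_induct)
  show "add_submonoid {f. int_combination A f}"
    by (auto simp: add_submonoid_def int_combination_zero int_combination_add)
qed (simp add: int_combination_inc assms(1))

lemma nonneg_rat_combination_inc:
  assumes "finite A" "a \<in> A"
  shows "nonneg_rat_combination A a"
  unfolding nonneg_rat_combination_def
  by (rule exI[of _ "\<lambda>b. if b = a then 1 else 0"]) (use assms in \<open>simp add: if_distrib[of "\<lambda>c. c * _"] cong: if_cong\<close>)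

lemma nonneg_rat_combination_add:
  assumes "nonneg_rat_combination A f" "nonneg_rat_combination A g"
  shows "nonneg_rat_combination A (f + g)"
proof -
  obtain c d where "\<forall>a\<in>A. 0 \<le> c a" "\<forall>a\<in>A. 0 \<le> d a"
    "\<forall>v. rat_of_int (Poly_Mapping.lookup f v) = (\<Sum>a\<in>A. c a * of_int (Poly_Mapping.lookup a v))"
    "\<forall>v. rat_of_int (Poly_Mapping.lookup g v) = (\<Sum>a\<in>A. d a * of_int (Poly_Mapping.lookup a v))"
    using assms unfolding nonneg_rat_combination_def by blast
  then show ?thesis
    unfolding nonneg_rat_combination_def
    by (intro exI[of _ "\<lambda>a. c a + d a"]) (simp add: lookup_add sum.distrib distrib_right)
qed

lemma add_submonoid_normal_monoid: "add_submonoid (normal_monoid V E)"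
  unfolding add_submonoid_def
proof (intro conjI ballI)
  have "nonneg_rat_combination (edge_elements E) 0"
    unfolding nonneg_rat_combination_def by (rule exI[of _ "\<lambda>_. 0"]) simp
  then show "0 \<in> normal_monoid V E"
    by (simp add: normal_monoid_def int_combination_zero)
  show "f + g \<in> normal_monoid V E" if "f \<in> normal_monoid V E" "g \<in> normal_monoid V E" for f g
    using that keys_add[of f g]
    by (auto simp: normal_monoid_def int_combination_add nonneg_rat_combination_add)
qed

lemma edge_element_in_normal_monoid:
  assumes "finite_graph V E" "a \<in> edge_elements E"
  shows "a \<in> normal_monoid V E"
proof -
  obtain x y where "{x, y} \<in> E" "a = frag_of x + frag_of y"
    using assms(2) by (auto simp: edge_elements_def)
  moreover from this have "{x, y} \<subseteq> V"
    using assms(1) unfolding finite_graph_def by blast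
  ultimately have "Poly_Mapping.keys a \<subseteq> V"
    using keys_add[of "frag_of x" "frag_of y"] by auto
  then show ?thesis
    using assms
    by (simp add: normal_monoid_def int_combination_inc nonneg_rat_combination_inc finite_edge_elements)
qed

lemma normal_monoid_nonneg:
  "f \<in> normal_monoid V E \<Longrightarrow> 0 \<le> Poly_Mapping.lookup f v"
proof -
  assume "f \<in> normal_monoid V E"
  then obtain c :: "_ \<Rightarrow> rat" where c: "\<forall>a\<in>edge_elements E. 0 \<le> c a"
    "rat_of_int (Poly_Mapping.lookup f v) = (\<Sum>a\<in>edge_elements E. c a * of_int (Poly_Mapping.lookup a v))"
    unfolding normal_monoid_def nonneg_rat_combination_def by blast
  have "0 \<le> (\<Sum>a\<in>edge_elements E. c a * rat_of_int (Poly_Mapping.lookup a v))"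
    using c(1) by (intro sum_nonneg mult_nonneg_nonneg) (auto simp: edge_elements_lookup_nonneg)
  then have "(0::rat) \<le> of_int (Poly_Mapping.lookup f v)"
    using c(2) by linarith
  then show ?thesis by linarith
qed

text \<open>An edge has both ends in \<open>K\<close> or none, so it contributes 2 or 0 to the sum.
  \<open>K\<close> will be the whole type, for the parity of the total degree, or a connected
  component.\<close>

lemma int_combination_even_on_closed:
  assumes "finite_graph V E" "int_combination (edge_elements E) f"
    and closed: "\<And>x y. {x, y} \<in> E \<Longrightarrow> x \<in> K \<longleftrightarrow> y \<in> K"
  shows "even (\<Sum>v\<in>V \<inter> K. Poly_Mapping.lookup f v)"
proof -
  obtain c where f: "f = (\<Sum>a\<in>edge_elements E. frag_cmul (c a) a)"
    using assms(2) unfolding int_combination_def by blast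
  have fin: "finite V" using assms(1) by (simp add: finite_graph_def)
  have "even (\<Sum>v\<in>V \<inter> K. Poly_Mapping.lookup a v)" if a: "a \<in> edge_elements E" for a
  proof -
    obtain x y where xy: "{x, y} \<in> E" "a = frag_of x + frag_of y"
      using a by (auto simp: edge_elements_def)
    then have "{x, y} \<subseteq> V" using assms(1) unfolding finite_graph_def by blast
    then show ?thesis
      using closed[OF xy(1)] fin xy(2) by (auto simp: lookup_add lookup_frag_of sum.distrib)
  qed
  then have "even (\<Sum>a\<in>edge_elements E. c a * (\<Sum>v\<in>V \<inter> K. Poly_Mapping.lookup a v))"
    by (intro dvd_sum) auto
  moreover have "(\<Sum>v\<in>V \<inter> K. Poly_Mapping.lookup f v)
      = (\<Sum>a\<in>edge_elements E. c a * (\<Sum>v\<in>V \<inter> K. Poly_Mapping.lookup a v))"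
    unfolding f lookup_sum by (subst sum.swap) (simp add: sum_distrib_left)
  ultimately show ?thesis by simp
qed

subsection \<open>Linear dependence\<close>

text \<open>Gaussian elimination: an equation with a nonzero entry at \<open>b\<close> eliminates
  that unknown, which leaves one equation and one unknown fewer.\<close>

lemma homogeneous_system_nontrivial_solution:
  fixes m :: "'b \<Rightarrow> 'c \<Rightarrow> 'k::field"
  assumes "finite W" "finite F" "card W < card F"
  shows "\<exists>d. (\<exists>a\<in>F. d a \<noteq> 0) \<and> (\<forall>v\<in>W. (\<Sum>a\<in>F. d a * m a v) = 0)"
  using assms
proof (induction W arbitrary: F m rule: finite_induct)
  case empty
  then have "F \<noteq> {}" by auto
  then show ?case by (intro exI[of _ "\<lambda>_. 1"]) auto
next
  case (insert w W)
  show ?case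
  proof (cases "\<forall>a\<in>F. m a w = 0")
    case True
    obtain d where "\<exists>a\<in>F. d a \<noteq> 0" "\<forall>v\<in>W. (\<Sum>a\<in>F. d a * m a v) = 0"
      using insert.IH[of F m] insert.prems insert.hyps by auto
    with True show ?thesis by (intro exI[of _ d]) auto
  next
    case False
    then obtain b where b: "b \<in> F" "m b w \<noteq> 0" by blast
    \<comment> \<open>A multiple of the pivot column \<open>b\<close> is subtracted from each column
      so that the row \<open>w\<close> becomes 0.\<close>
    define m' where "m' a v = m a v - m a w / m b w * m b v" for a v
    have "card W < card (F - {b})"
      using insert b by simp
    then obtain d where d: "\<exists>a\<in>F - {b}. d a \<noteq> 0"
      "\<forall>v\<in>W. (\<Sum>a\<in>F - {b}. d a * m' a v) = 0"
      using insert.IH[of "F - {b}" m'] insert.prems by blast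
    \<comment> \<open>The value at \<open>b\<close> is the one forced by the equation for
      \<open>w\<close>.\<close>
    define d' where "d' = d(b := - (\<Sum>a\<in>F - {b}. d a * m a w) / m b w)"
    have split: "(\<Sum>a\<in>F. d' a * m a v) = d' b * m b v + (\<Sum>a\<in>F - {b}. d a * m a v)" for v
      using b insert.prems by (simp add: sum.remove[of F b] d'_def)
    have "(\<Sum>a\<in>F. d' a * m a w) = 0"
      unfolding split using b by (simp add: d'_def)
    moreover have "(\<Sum>a\<in>F. d' a * m a v) = 0" if "v \<in> W" for v
    proof -
      have "(\<Sum>a\<in>F - {b}. d a * m' a v)
        = (\<Sum>a\<in>F - {b}. d a * m a v) - (\<Sum>a\<in>F - {b}. d a * m a w) / m b w * m b v"
        unfolding m'_def by (simp add: right_diff_distrib sum_subtractf sum_distrib_right sum_divide_distrib mult.assoc)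
      then show ?thesis
        using d(2) that unfolding split by (simp add: d'_def)
    qed
    ultimately show ?thesis
      using d(1) by (intro exI[of _ d']) (auto simp: d'_def)
  qed
qed

subsection \<open>Walks and cycles\<close>

lemma walk_edges_simps [simp]:
  "walk_edges [] = []" "walk_edges [x] = []"
  "walk_edges (x # y # r) = {x, y} # walk_edges (y # r)"
  by (simp_all add: walk_edges_def)

lemma walk_edges_append:
  "walk_edges (xs @ y # ys) = walk_edges (xs @ [y]) @ walk_edges (y # ys)"
  by (induction xs rule: induct_list012) auto

lemma walk_edges_sublist: "set (walk_edges ys) \<subseteq> set (walk_edges (xs @ ys @ zs))"
proof -
  have "set (walk_edges ys) \<subseteq> set (walk_edges (ys @ zs))"
    by (induction ys rule: induct_list012) auto
  moreover have "set (walk_edges us) \<subseteq> set (walk_edges (xs @ us))" for us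
  proof (cases us)
    case (Cons a r)
    then show ?thesis using walk_edges_append[of xs a r] by auto
  qed simp
  ultimately show ?thesis by blast
qed

text \<open>A cycle lists its vertices without repeating the first one.\<close>

definition cycle_edges :: "'a list \<Rightarrow> 'a set list" where
  "cycle_edges vs = map2 (\<lambda>u v. {u, v}) vs (rotate1 vs)"

text \<open>Repeated edges are allowed, so two adjacent vertices form a cycle \<open>[x, y]\<close>
  of even length that runs twice through one edge. Where the edges must be distinct, length 2 is
  excluded explicitly. A loop is the list \<open>[x]\<close>.\<close>

definition cycle :: "'a set set \<Rightarrow> 'a list \<Rightarrow> bool" where
  "cycle E vs \<longleftrightarrow> vs \<noteq> [] \<and> distinct vs \<and> set (cycle_edges vs) \<subseteq> E"

lemma length_cycle_edges [simp]: "length (cycle_edges vs) = length vs"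
  by (simp add: cycle_edges_def)

lemma cycle_edges_nth:
  "i < length vs \<Longrightarrow> cycle_edges vs ! i = {vs ! i, vs ! (Suc i mod length vs)}"
  by (simp add: cycle_edges_def nth_rotate1)

lemma cycle_edges_Cons: "cycle_edges (x # xs) = walk_edges (x # xs @ [x])"
  using zip_append1[of "x # xs" "[x]" "xs @ [x]"] by (simp add: cycle_edges_def walk_edges_def)

lemma walk_edges_close: "vs \<noteq> [] \<Longrightarrow> walk_edges (vs @ [hd vs]) = cycle_edges vs"
  by (cases vs) (simp_all add: cycle_edges_Cons)

lemma set_close: "vs \<noteq> [] \<Longrightarrow> set (vs @ [hd vs]) = set vs"
  by auto

lemma cycle_edges_rotate: "set (cycle_edges (rotate n vs)) = set (cycle_edges vs)"
proof (induction n)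
  case (Suc n)
  have "map2 g (rotate1 us) (rotate1 ws) = rotate1 (map2 g us ws)" if "length us = length ws"
    for g :: "'a \<Rightarrow> 'a \<Rightarrow> 'a set" and us ws
    using that by (cases us; cases ws) auto
  then have "cycle_edges (rotate1 us) = rotate1 (cycle_edges us)" for us :: "'a list"
    by (simp add: cycle_edges_def)
  with Suc show ?case by simp
qed simp

lemma cycle_rotate_to:
  assumes "cycle E vs" "x \<in> set vs"
  obtains as where "cycle E (x # as)" "set (x # as) = set vs" "length (x # as) = length vs"
    "set (cycle_edges (x # as)) = set (cycle_edges vs)"
proof -
  obtain bs cs where vs: "vs = bs @ x # cs" using assms(2) split_list by fast
  then have rot: "rotate (length bs) vs = x # cs @ bs" by (simp add: rotate_append)
  show thesis
    using assms(1) cycle_edges_rotate[of "length bs" vs, unfolded rot] vs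
    by (intro that[of "cs @ bs"]) (auto simp: cycle_def)
qed

text \<open>If the edges at two different positions agree, each position is the successor of the
  other modulo the length, which happens only for length 2.\<close>

lemma distinct_cycle_edges:
  assumes "distinct vs" "length vs \<noteq> 2"
  shows "distinct (cycle_edges vs)"
  unfolding distinct_conv_nth
proof (intro allI impI notI)
  fix i j
  assume ij: "i < length (cycle_edges vs)" "j < length (cycle_edges vs)" "i \<noteq> j"
    and eq: "cycle_edges vs ! i = cycle_edges vs ! j"
  let ?k = "length vs"
  have k: "i < ?k" "j < ?k" "Suc i mod ?k < ?k" "Suc j mod ?k < ?k"
    using ij by simp_all (use ij in \<open>auto intro: mod_less_divisor\<close>)
  have "vs ! i \<noteq> vs ! j"
    using assms(1) ij k by (simp add: nth_eq_iff_index_eq)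
  then have "vs ! i = vs ! (Suc j mod ?k)" "vs ! j = vs ! (Suc i mod ?k)"
    using eq k by (auto simp: cycle_edges_nth doubleton_eq_iff)
  then have "i = Suc j mod ?k" "j = Suc i mod ?k"
    using assms(1) k by (simp_all add: nth_eq_iff_index_eq)
  then show False
    using k ij assms(2) by (auto simp: mod_Suc split: if_splits)
qed

text \<open>Odd length excludes the doubled edge, the only case in which distinct vertices do not
  already give distinct edges.\<close>

lemma odd_circuit_iff_cycle:
  "odd_circuit E p \<longleftrightarrow> (\<exists>vs. p = vs @ [hd vs] \<and> cycle E vs \<and> odd (length vs))"
proof
  assume p: "odd_circuit E p"
  then have ne: "p \<noteq> []" "tl p \<noteq> []"
    by (auto simp: odd_circuit_def circuit_def walk_def walk_edges_def)
  define vs where "vs = butlast p"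
  have "vs \<noteq> []" using ne by (cases p) (auto simp: vs_def)
  moreover from this have pv: "p = vs @ [hd vs]"
    using p ne unfolding vs_def
    by (metis append_butlast_last_id circuit_def hd_append2 odd_circuit_def)
  ultimately have "distinct vs"
    using p by (cases vs) (auto simp: odd_circuit_def circuit_def)
  with p pv \<open>vs \<noteq> []\<close> show "\<exists>vs. p = vs @ [hd vs] \<and> cycle E vs \<and> odd (length vs)"
    by (intro exI[of _ vs])
      (metis circuit_def cycle_def length_cycle_edges odd_circuit_def walk_def walk_edges_close)
next
  assume "\<exists>vs. p = vs @ [hd vs] \<and> cycle E vs \<and> odd (length vs)"
  then obtain vs where vs: "p = vs @ [hd vs]" "cycle E vs" "odd (length vs)" by blast
  then have "vs \<noteq> []" "distinct vs" "length vs \<noteq> 2"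
    by (auto simp: cycle_def simp del: length_0_conv)
  then have "distinct (cycle_edges vs)"
    by (simp add: distinct_cycle_edges)
  moreover have "cycle_edges vs \<noteq> []" using \<open>vs \<noteq> []\<close> length_cycle_edges[of vs] by force
  moreover have "distinct (tl p)" using vs by (cases vs) (auto simp: cycle_def)
  ultimately show "odd_circuit E p"
    using vs by (simp add: odd_circuit_def circuit_def walk_def walk_edges_close cycle_def)
qed

text \<open>The counterpart of \<open>cycle_edges\<close> in the group, in the same order, so that
  the two lists can be compared position by position.\<close>

definition cycle_frags :: "'a list \<Rightarrow> ('a \<Rightarrow>\<^sub>0 int) list" where
  "cycle_frags vs = map2 (\<lambda>u v. frag_of u + frag_of v) vs (rotate1 vs)"

lemma cycle_frags_nth:
  "i < length vs \<Longrightarrow> cycle_frags vs ! i = frag_of (vs ! i) + frag_of (vs ! (Suc i mod length vs))"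
  by (simp add: cycle_frags_def nth_rotate1)

lemma length_cycle_frags [simp]: "length (cycle_frags vs) = length vs"
  by (simp add: cycle_frags_def)

lemma cycle_frags_iff:
  "frag_of x + frag_of y \<in> set (cycle_frags vs) \<longleftrightarrow> {x, y} \<in> set (cycle_edges vs)"
  by (auto simp: in_set_conv_nth cycle_frags_nth cycle_edges_nth frag_pair_eq_iff)

lemma cycle_frags_subset:
  assumes "cycle E vs"
  shows "set (cycle_frags vs) \<subseteq> edge_elements E"
proof
  fix a assume a: "a \<in> set (cycle_frags vs)"
  then obtain x y where "a = frag_of x + frag_of y" by (auto simp: cycle_frags_def)
  with a assms show "a \<in> edge_elements E"
    by (auto simp: cycle_def cycle_frags_iff edge_elements_iff)
qed

lemma distinct_cycle_frags:
  assumes "distinct vs" "length vs \<noteq> 2"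
  shows "distinct (cycle_frags vs)"
  using distinct_cycle_edges[OF assms]
  by (auto simp: distinct_conv_nth cycle_frags_nth cycle_edges_nth frag_pair_eq_iff)

lemma keys_cycle_frags:
  assumes "a \<in> set (cycle_frags vs)"
  shows "Poly_Mapping.keys a \<subseteq> set vs"
proof -
  obtain x y where "a = frag_of x + frag_of y" "x \<in> set vs" "y \<in> set vs"
    using assms set_zip_leftD set_zip_rightD unfolding cycle_frags_def by fastforce
  then show ?thesis using keys_add[of "frag_of x" "frag_of y"] by auto
qed

text \<open>Every vertex is an end of two consecutive edges, or of one loop counted twice. For
  length 2 the set would contain the doubled edge only once.\<close>

lemma sum_cycle_frags:
  assumes "distinct vs" "length vs \<noteq> 2"
  shows "\<Sum>(set (cycle_frags vs)) = frag_cmul 2 (char_element (set vs))"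
proof -
  have *: "sum_list (map2 (\<lambda>u v. frag_of u + frag_of v) us ws)
      = sum_list (map frag_of us) + sum_list (map frag_of ws)"
    if "length us = length ws" for us ws :: "'a list"
    using that by (induction us ws rule: list_induct2) (auto simp: algebra_simps)
  have "sum_list (map frag_of (rotate1 vs)) = sum_list (map frag_of vs)"
    by (cases vs) auto
  then have "sum_list (cycle_frags vs) = sum_list (map frag_of vs) + sum_list (map frag_of vs)"
    unfolding cycle_frags_def using *[of vs "rotate1 vs"] by simp
  then show ?thesis
    using assms frag_cmul_distrib[of 1 1 "char_element (set vs)"]
    by (simp add: distinct_sum_list_conv_Sum distinct_cycle_frags char_element_set)
qed

subsection \<open>Connected components\<close>

definition conn :: "'a set set \<Rightarrow> ('a \<times> 'a) set" where
  "conn E = {(u, v). {u, v} \<in> E}\<^sup>*"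

lemma conn_sym: "(u, v) \<in> conn E \<Longrightarrow> (v, u) \<in> conn E"
proof -
  have "sym {(u, v). {u, v} \<in> E}" by (auto simp: sym_def insert_commute)
  then show "(u, v) \<in> conn E \<Longrightarrow> (v, u) \<in> conn E"
    unfolding conn_def using sym_rtrancl[of "{(u, v). {u, v} \<in> E}"] by (auto simp: sym_def)
qed

lemma conn_trans: "(u, v) \<in> conn E \<Longrightarrow> (v, w) \<in> conn E \<Longrightarrow> (u, w) \<in> conn E"
  unfolding conn_def by (rule rtrancl_trans)

lemma connected_by_walk_iff: "connected_by_walk E u v \<longleftrightarrow> (u, v) \<in> conn E"
proof
  have "(hd p, last p) \<in> conn E" if "walk E p" for p
    using that unfolding conn_def
    by (induction p rule: induct_list012) (auto simp: walk_def intro: converse_rtrancl_into_rtrancl)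
  then show "connected_by_walk E u v \<Longrightarrow> (u, v) \<in> conn E"
    by (auto simp: connected_by_walk_def)
next
  assume "(u, v) \<in> conn E"
  then show "connected_by_walk E u v"
    unfolding conn_def
  proof (induction rule: converse_rtrancl_induct)
    case base
    show ?case
      unfolding connected_by_walk_def by (intro exI[of _ "[v]"]) (simp add: walk_def)
  next
    case (step y z)
    then obtain p where "walk E p" "hd p = z" "last p = v"
      unfolding connected_by_walk_def by blast
    with step.hyps show ?case
      unfolding connected_by_walk_def by (intro exI[of _ "y # p"]) (cases p; auto simp: walk_def)
  qed
qed

lemma cycle_conn:
  assumes "cycle E vs" "u \<in> set vs" "v \<in> set vs"
  shows "(u, v) \<in> conn E"
proof -
  obtain as where as: "cycle E (u # as)" "set (u # as) = set vs"
    using cycle_rotate_to[OF assms(1,2)] by metis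
  obtain xs ys where split: "u # as = xs @ v # ys"
    using as(2) assms(3) split_list by metis
  have "set (walk_edges (u # as)) \<subseteq> E"
    using as(1) walk_edges_sublist[of "u # as" "[]" "[u]"] by (auto simp: cycle_def cycle_edges_Cons)
  then have "walk E (xs @ [v])"
    using walk_edges_append[of xs v ys] unfolding split by (simp add: walk_def)
  moreover have "hd (xs @ [v]) = u" using split by (cases xs) auto
  ultimately show ?thesis
    unfolding connected_by_walk_iff[symmetric] connected_by_walk_def by (intro exI[of _ "xs @ [v]"]) simp
qed

subsection \<open>Pairs of odd cycles\<close>

text \<open>The first, third, fifth edge and so on cover each entry of the list exactly once; hence
  the induction by two vertices at a time.\<close>

lemma even_walk_in_hull:
  "even (length as) \<Longrightarrow> set (walk_edges as) \<subseteq> E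
    \<Longrightarrow> sum_list (map frag_of as) \<in> add_submonoid hull (edge_elements E)"
proof (induction as rule: induct_list012)
  case (3 x y zs)
  have "set (walk_edges zs) \<subseteq> E"
    using 3(4) walk_edges_sublist[of zs "[x, y]" "[]"] by auto
  moreover have "frag_of x + frag_of y \<in> edge_elements E"
    using 3(4) by (simp add: edge_elements_iff)
  ultimately show ?case
    using 3 hull_add[OF hull_inc] by (fastforce simp: add.assoc[symmetric])
qed (simp_all add: hull_zero)

lemma even_cycle_in_hull:
  assumes "cycle E vs" "even (length vs)"
  shows "char_element (set vs) \<in> add_submonoid hull (edge_elements E)"
  using assms walk_edges_sublist[of vs "[]" "[hd vs]"] even_walk_in_hull[of vs E]
  by (auto simp: cycle_def char_element_set walk_edges_close[symmetric])

text \<open>Cutting the cycle open at \<open>x\<close> leaves a path with an even number of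
  vertices, empty if the cycle is a loop. Modulo edges, an odd cycle can thus be replaced by any one
  of its vertices.\<close>

lemma odd_cycle_minus_vertex:
  assumes "cycle E vs" "odd (length vs)" "x \<in> set vs"
  obtains a where "a \<in> add_submonoid hull (edge_elements E)" "char_element (set vs) = frag_of x + a"
proof -
  obtain as where as: "cycle E (x # as)" "set (x # as) = set vs" "length (x # as) = length vs"
    using cycle_rotate_to[OF assms(1,3)] by metis
  have "set (walk_edges as) \<subseteq> E"
    using as(1) walk_edges_sublist[of as "[x]" "[x]"] by (auto simp: cycle_def cycle_edges_Cons)
  moreover have "even (length as)" using as(3) assms(2) by (metis even_Suc length_Cons)
  ultimately have "sum_list (map frag_of as) \<in> add_submonoid hull (edge_elements E)"
    by (rule even_walk_in_hull[rotated])
  moreover have "char_element (set vs) = frag_of x + sum_list (map frag_of as)"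
    using as(1) by (simp add: cycle_def char_element_set flip: as(2) del: set_simps)
  ultimately show thesis by (rule that)
qed

text \<open>A chord splits an odd cycle into two paths, exactly one of which has an even number of inner
  vertices; the other one closes up to a shorter odd cycle.\<close>

lemma odd_cycle_chord:
  assumes "cycle E vs" "odd (length vs)" "{x, y} \<in> E" "{x, y} \<subseteq> set vs"
    "{x, y} \<notin> set (cycle_edges vs)"
  obtains us as where "cycle E us" "odd (length us)" "as \<noteq> []" "even (length as)"
    "set (walk_edges as) \<subseteq> E" "distinct (us @ as)" "set us \<union> set as = set vs"
proof -
  obtain as where as: "cycle E (x # as)" "set (x # as) = set vs" "length (x # as) = length vs"
    "set (cycle_edges (x # as)) = set (cycle_edges vs)"
    using cycle_rotate_to[OF assms(1), of x] assms(4) by auto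
  have even: "even (length as)" using as(3) assms(2) by (metis even_Suc length_Cons)
  have E: "set (walk_edges (x # as @ [x])) \<subseteq> E"
    using as(1) by (simp add: cycle_def cycle_edges_Cons)
  have notin: "{x, y} \<notin> set (walk_edges (x # as @ [x]))"
    using assms(5) as(4) by (simp add: cycle_edges_Cons)
  show thesis
  \<comment> \<open>A chord that is a loop is itself the shorter odd cycle, and all remaining
    vertices form the even path.\<close>
  proof (cases "y = x")
    case True
    have "set (walk_edges as) \<subseteq> E"
      using E walk_edges_sublist[of as "[x]" "[x]"] by auto
    moreover have "as \<noteq> []" using notin True by auto
    ultimately show thesis
      using that[of "[x]" as] as even True assms(3) by (auto simp: cycle_def cycle_edges_Cons)
  next
    case False
    then obtain bs cs where split: "as = bs @ y # cs"
      using as(2) assms(4) split_list by (metis insert_subset list.simps(15) insertE)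
    \<comment> \<open>If no vertex lay between \<open>x\<close> and \<open>y\<close> on one side,
      \<open>{x, y}\<close> would be an edge of the cycle.\<close>
    have ne: "bs \<noteq> []" "cs \<noteq> []"
      using notin walk_edges_append[of "x # bs" y "cs @ [x]"]
      unfolding split by (auto simp: insert_commute)
    have sub: "set (walk_edges bs) \<subseteq> E" "set (walk_edges cs) \<subseteq> E"
      "set (walk_edges (x # bs @ [y])) \<subseteq> E" "set (walk_edges (y # cs @ [x])) \<subseteq> E"
      using E walk_edges_sublist[of bs "[x]" "y # cs @ [x]"] walk_edges_sublist[of cs "x # bs @ [y]" "[x]"]
        walk_edges_sublist[of "x # bs @ [y]" "[]" "cs @ [x]"]
        walk_edges_sublist[of "y # cs @ [x]" "x # bs" "[]"]
      unfolding split by auto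
    have dist: "distinct (x # bs @ y # cs)" using as(1) by (simp add: cycle_def split)
    show thesis
    proof (cases "even (length bs)")
      case True
      have "cycle E (y # cs @ [x])"
        using sub(4) dist assms(3) walk_edges_append[of "y # cs" x "[y]"] by (auto simp: cycle_def cycle_edges_Cons)
      then show thesis
        using that[of "y # cs @ [x]" bs] True ne sub even dist as(2) by (auto simp: split insert_commute Un_commute Int_commute)
    next
      case False
      have "cycle E (x # bs @ [y])"
        using sub(3) dist assms(3) walk_edges_append[of "x # bs" y "[x]"]
        by (auto simp: cycle_def cycle_edges_Cons insert_commute)
      then show thesis
        using that[of "x # bs @ [y]" cs] False ne sub even dist as(2) by (auto simp: split)
    qed
  qed
qed

text \<open>Induction on the number of vertices. Connectedness is assumed for all pairs of vertices,
  rather than for two chosen ones, so that it passes to cycles on fewer of the same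
  vertices.\<close>

lemma odd_cycle_pair_in_hull:
  assumes "finite_graph V E" "cycle E vs" "cycle E ws" "odd (length vs)" "odd (length ws)"
    "set vs \<inter> set ws = {}" "\<And>u w. u \<in> set vs \<Longrightarrow> w \<in> set ws \<Longrightarrow> (u, w) \<in> conn E"
  shows "char_element (set vs) + char_element (set ws)
    \<in> add_submonoid hull (edge_elements E \<union> exceptional_elements E)"
  using assms(2-)
proof (induction "card (set vs) + card (set ws)" arbitrary: vs ws rule: less_induct)
  case less
  let ?H = "add_submonoid hull (edge_elements E \<union> exceptional_elements E)"
  have sub: "add_submonoid hull (edge_elements E) \<subseteq> ?H" by (rule hull_mono) simp
  \<comment> \<open>The new odd cycle uses only old vertices, so disjointness and connectedness
    persist; the split-off path is nonempty, so the induction measure drops.\<close>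
  have shrink: "\<exists>us a. cycle E us \<and> odd (length us) \<and> set us \<subset> set zs \<and> a \<in> ?H
      \<and> char_element (set zs) = char_element (set us) + a"
    if chord: "cycle E zs" "odd (length zs)" "{x, y} \<in> E" "{x, y} \<subseteq> set zs" "{x, y} \<notin> set (cycle_edges zs)"
    for zs x y
  proof -
    obtain us as where us: "cycle E us" "odd (length us)" "as \<noteq> []" "even (length as)"
      "set (walk_edges as) \<subseteq> E" "distinct (us @ as)" "set us \<union> set as = set zs"
      by (rule odd_cycle_chord[OF chord])
    have "char_element (set as) \<in> ?H"
      using even_walk_in_hull[OF us(4,5)] us(6) sub by (auto simp: char_element_set)
    moreover have "char_element (set zs) = char_element (set us) + char_element (set as)"
      using us(6) by (simp add: char_element_Un flip: us(7))
    moreover have "set us \<subset> set zs"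
      using us(3,6) by (auto simp: neq_Nil_conv simp flip: us(7))
    ultimately show ?thesis using us(1,2) by blast
  qed
  show ?case
  proof (cases "exceptional_pair E (vs @ [hd vs]) (ws @ [hd ws])")
    case True
    have "vs \<noteq> []" "ws \<noteq> []" using less.prems by (auto simp: cycle_def)
    then have "set (vs @ [hd vs]) \<union> set (ws @ [hd ws]) = set vs \<union> set ws"
      by (simp add: set_close del: set_append)
    then have "char_element (set vs \<union> set ws) \<in> exceptional_elements E"
      using True unfolding exceptional_elements_def by (metis (mono_tags, lifting) mem_Collect_eq)
    then show ?thesis
      using less.prems(5) by (simp add: char_element_Un hull_inc)
  next
    case False
    have ne: "vs \<noteq> []" "ws \<noteq> []" using less.prems by (auto simp: cycle_def)
    have "set (cycle_edges zs) \<subseteq> {e \<in> E. e \<subseteq> set zs}" if "cycle E zs" for zs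
      using that unfolding cycle_def cycle_edges_def
      by (auto dest: set_zip_leftD set_zip_rightD)
    from this[OF less.prems(1)] this[OF less.prems(2)]
    have "set (cycle_edges vs) \<union> set (cycle_edges ws) \<subseteq> {e \<in> E. e \<subseteq> set vs \<union> set ws}"
      by blast
    moreover have "odd_circuit E (vs @ [hd vs])" "odd_circuit E (ws @ [hd ws])"
      using less.prems by (auto simp: odd_circuit_iff_cycle)
    moreover have "connected_by_walk E (hd vs) (hd ws)"
      using ne less.prems(6) by (simp add: connected_by_walk_iff)
    \<comment> \<open>The circuit edges always lie inside the union, so a pair that fails to be
      exceptional has an additional edge there.\<close>
    ultimately obtain e where e: "e \<in> E" "e \<subseteq> set vs \<union> set ws"
      "e \<notin> set (cycle_edges vs)" "e \<notin> set (cycle_edges ws)"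
      using False ne less.prems(5)
      by (auto simp: exceptional_pair_def walk_edges_close set_close simp del: set_append)
    have "card e = 1 \<or> card e = 2" using assms(1) e(1) by (simp add: finite_graph_def)
    then obtain x y where "e = {x, y}"
      by (auto simp: card_1_singleton_iff card_2_iff)
    then have xy: "{x, y} \<in> E" "x \<in> set vs \<union> set ws" "y \<in> set vs \<union> set ws"
      "{x, y} \<notin> set (cycle_edges vs)" "{x, y} \<notin> set (cycle_edges ws)" "{y, x} \<in> E"
      using e by (auto simp: insert_commute)
    consider "{x, y} \<subseteq> set vs" | "{x, y} \<subseteq> set ws" | u v where "{u, v} \<in> E" "u \<in> set vs" "v \<in> set ws"
      using xy by blast
    then show ?thesis
    proof cases
      case 1
      then obtain us a where us: "cycle E us" "odd (length us)" "set us \<subset> set vs" "a \<in> ?H"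
        "char_element (set vs) = char_element (set us) + a"
        using shrink[OF less.prems(1,3) xy(1) 1 xy(4)] by metis
      have "char_element (set us) + char_element (set ws) \<in> ?H"
        using less.prems us psubset_card_mono[OF _ us(3)] by (intro less.hyps) auto
      from hull_add[OF this us(4)] show ?thesis by (simp add: us(5) algebra_simps)
    next
      case 2
      then obtain us a where us: "cycle E us" "odd (length us)" "set us \<subset> set ws" "a \<in> ?H"
        "char_element (set ws) = char_element (set us) + a"
        using shrink[OF less.prems(2,4) xy(1) 2 xy(5)] by metis
      have "char_element (set vs) + char_element (set us) \<in> ?H"
        using less.prems us psubset_card_mono[OF _ us(3)] by (intro less.hyps) auto
      from hull_add[OF this us(4)] show ?thesis by (simp add: us(5) algebra_simps)
    next
      \<comment> \<open>A connecting edge needs no induction: after removing its ends both cycles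
        become even paths, and the whole pair is a sum of edges.\<close>
      case (3 u v)
      obtain a where a: "a \<in> add_submonoid hull (edge_elements E)"
        "char_element (set vs) = frag_of u + a"
        by (rule odd_cycle_minus_vertex[OF less.prems(1,3) 3(2)])
      obtain b where b: "b \<in> add_submonoid hull (edge_elements E)"
        "char_element (set ws) = frag_of v + b"
        by (rule odd_cycle_minus_vertex[OF less.prems(2,4) 3(3)])
      have ab: "a \<in> ?H" "b \<in> ?H" using a(1) b(1) sub by blast+
      have "frag_of u + frag_of v \<in> ?H"
        using 3(1) by (simp add: edge_elements_iff hull_inc)
      then have "(frag_of u + frag_of v) + (a + b) \<in> ?H"
        by (rule hull_add[OF _ hull_add[OF ab(1,2)]])
      then show ?thesis by (simp add: a(2) b(2) algebra_simps)
    qed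
  qed
qed

subsection \<open>Exceptional pairs are irreducible elements of the normal monoid\<close>

lemma cycle_subset_vertices:
  assumes "finite_graph V E" "cycle E vs"
  shows "set vs \<subseteq> V"
proof
  fix v assume "v \<in> set vs"
  then obtain i where i: "i < length vs" "v = vs ! i" by (auto simp: in_set_conv_nth)
  then have "cycle_edges vs ! i \<in> E"
    using assms(2) unfolding cycle_def by (metis length_cycle_edges nth_mem subsetD)
  then have "cycle_edges vs ! i \<subseteq> V" using assms(1) by (simp add: finite_graph_def)
  then show "v \<in> V" using i by (simp add: cycle_edges_nth)
qed

lemma exceptional_element_cases:
  assumes "h \<in> exceptional_elements E"
  obtains vs ws where "cycle E vs" "cycle E ws" "odd (length vs)" "odd (length ws)"
    "set vs \<inter> set ws = {}" "(hd vs, hd ws) \<in> conn E" "h = char_element (set vs \<union> set ws)"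
    "{e \<in> E. e \<subseteq> set vs \<union> set ws} = set (cycle_edges vs) \<union> set (cycle_edges ws)"
proof -
  obtain p q where h: "h = char_element (set p \<union> set q)" and pq: "exceptional_pair E p q"
    using assms by (auto simp: exceptional_elements_def)
  obtain vs where vs: "p = vs @ [hd vs]" "cycle E vs" "odd (length vs)"
    using pq by (auto simp: exceptional_pair_def odd_circuit_iff_cycle)
  obtain ws where ws: "q = ws @ [hd ws]" "cycle E ws" "odd (length ws)"
    using pq by (auto simp: exceptional_pair_def odd_circuit_iff_cycle)
  have ne: "vs \<noteq> []" "ws \<noteq> []" using vs(2) ws(2) by (auto simp: cycle_def)
  then have "set p = set vs" "set q = set ws" "hd p = hd vs" "hd q = hd ws"
    "walk_edges p = cycle_edges vs" "walk_edges q = cycle_edges ws"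
    using set_close[of vs] set_close[of ws]
    by (auto simp: vs(1)[symmetric] ws(1)[symmetric] walk_edges_close[symmetric])
      (metis vs(1) ws(1) hd_append2)+
  then show thesis
    using that[of vs ws] vs ws pq h by (simp add: exceptional_pair_def connected_by_walk_iff)
qed

lemma odd_cycle_rat_combination:
  assumes "finite_graph V E" "cycle E vs" "odd (length vs)"
  shows "nonneg_rat_combination (edge_elements E) (char_element (set vs))"
proof -
  have len: "distinct vs" "length vs \<noteq> 2"
    using assms(2,3) by (auto simp: cycle_def simp del: length_0_conv)
  \<comment> \<open>Each vertex of the cycle lies on two of its edges, hence the weight 1/2.\<close>
  define c :: "_ \<Rightarrow> rat" where "c a = (if a \<in> set (cycle_frags vs) then 1/2 else 0)" for a
  have "(\<Sum>a\<in>edge_elements E. c a * of_int (Poly_Mapping.lookup a v))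
      = of_int (Poly_Mapping.lookup (char_element (set vs)) v)" for v
  proof -
    have "(\<Sum>a\<in>edge_elements E. c a * of_int (Poly_Mapping.lookup a v))
      = (\<Sum>a\<in>set (cycle_frags vs). 1/2 * of_int (Poly_Mapping.lookup a v))"
      using finite_edge_elements[OF assms(1)] cycle_frags_subset[OF assms(2)]
      by (intro sum.mono_neutral_cong_right) (auto simp: c_def)
    also have "\<dots> = 1/2 * of_int (Poly_Mapping.lookup (\<Sum>(set (cycle_frags vs))) v)"
      by (simp add: lookup_sum sum_distrib_left)
    finally show ?thesis by (simp add: sum_cycle_frags[OF len])
  qed
  then show ?thesis
    unfolding nonneg_rat_combination_def by (intro exI[of _ c]) (simp add: c_def)
qed

section \<open>Integrality of exceptional pairs\<close>

lemma int_combination_sum: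
  "(\<And>x. x \<in> S \<Longrightarrow> int_combination A (f x)) \<Longrightarrow> int_combination A (sum f S)"
  by (induction S rule: infinite_finite_induct) (auto intro: int_combination_zero int_combination_add)

text \<open>Along a walk, edges with alternating signs cancel the inner vertices. The sign left at
  \<open>y\<close> depends on the parity of the walk, which is not known.\<close>

lemma int_combination_conn:
  assumes "finite_graph V E" "(x, y) \<in> conn E"
  shows "int_combination (edge_elements E) (frag_of x - frag_of y)
    \<or> int_combination (edge_elements E) (frag_of x + frag_of y)"
  using assms(2) unfolding conn_def
proof (induction rule: rtrancl_induct)
  case base
  then show ?case by (simp add: int_combination_zero)
next
  case (step y z)
  then have yz: "int_combination (edge_elements E) (frag_of y + frag_of z)"
    using finite_edge_elements[OF assms(1)] by (intro int_combination_inc) (simp_all add: edge_elements_iff)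
  from step.IH show ?case
  proof
    assume "int_combination (edge_elements E) (frag_of x - frag_of y)"
    from int_combination_add[OF this yz] show ?thesis by (simp add: algebra_simps)
  next
    assume "int_combination (edge_elements E) (frag_of x + frag_of y)"
    from int_combination_diff[OF this yz] show ?thesis by (simp add: algebra_simps)
  qed
qed

text \<open>Modulo edges the two cycles reduce to single vertices \<open>x\<close> and
  \<open>y\<close>, and the connection gives \<open>x + y\<close> or \<open>x - y\<close>. In the
  second case \<open>2y\<close> repairs the sign; it is integral because the edges of the odd cycle
  \<open>ws\<close> sum to twice its characteristic function, which is \<open>2y\<close> modulo
  edges.\<close>

lemma exceptional_in_normal_monoid:
  assumes "finite_graph V E" "h \<in> exceptional_elements E"
  shows "h \<in> normal_monoid V E"
proof -
  let ?A = "edge_elements E"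
  from assms(2) obtain vs ws where vw: "cycle E vs" "cycle E ws" "odd (length vs)" "odd (length ws)"
    "set vs \<inter> set ws = {}" "(hd vs, hd ws) \<in> conn E" "h = char_element (set vs \<union> set ws)"
    by (elim exceptional_element_cases)
  have fin: "finite ?A" by (rule finite_edge_elements[OF assms(1)])
  have h: "h = char_element (set vs) + char_element (set ws)"
    using vw by (simp add: char_element_Un)
  define x y where "x = hd vs" and "y = hd ws"
  have xy: "x \<in> set vs" "y \<in> set ws" using vw(1,2) by (auto simp: x_def y_def cycle_def)
  obtain a where a: "a \<in> add_submonoid hull ?A" "char_element (set vs) = frag_of x + a"
    using odd_cycle_minus_vertex[OF vw(1,3) xy(1)] by metis
  obtain b where b: "b \<in> add_submonoid hull ?A" "char_element (set ws) = frag_of y + b"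
    using odd_cycle_minus_vertex[OF vw(2,4) xy(2)] by metis
  have ab: "int_combination ?A a" "int_combination ?A b"
    using a(1) b(1) int_combination_hull[OF fin] by blast+
  have "length ws \<noteq> 2" "distinct ws" using vw(2,4) by (auto simp: cycle_def simp del: length_0_conv)
  moreover have "int_combination ?A (\<Sum>(set (cycle_frags ws)))"
    using cycle_frags_subset[OF vw(2)] by (intro int_combination_sum int_combination_inc[OF fin]) auto
  ultimately have "int_combination ?A (frag_cmul 2 (frag_of y + b))"
    by (simp add: sum_cycle_frags b(2))
  from int_combination_diff[OF this int_combination_cmul[OF ab(2), of 2]]
  have "int_combination ?A (frag_cmul 2 (frag_of y))"
    by (simp add: frag_cmul_distrib2)
  then have 2: "int_combination ?A (frag_of y + frag_of y)"
    using frag_cmul_distrib[of 1 1 "frag_of y"] by simp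
  have "int_combination ?A (frag_of x + frag_of y)"
    using int_combination_conn[OF assms(1) vw(6)]
  proof
    assume "int_combination ?A (frag_of (hd vs) - frag_of (hd ws))"
    from int_combination_add[OF this 2] show ?thesis by (simp add: x_def y_def algebra_simps)
  qed (simp add: x_def y_def)
  from int_combination_add[OF this int_combination_add[OF ab]]
  have "int_combination ?A h" by (simp add: h a(2) b(2) algebra_simps)
  moreover have "nonneg_rat_combination ?A h"
    unfolding h using vw by (intro nonneg_rat_combination_add odd_cycle_rat_combination[OF assms(1)])
  moreover have "Poly_Mapping.keys h \<subseteq> V"
    using cycle_subset_vertices[OF assms(1) vw(1)] cycle_subset_vertices[OF assms(1) vw(2)]
    by (auto simp: vw(7) in_keys_iff lookup_char_element split: if_splits)
  ultimately show ?thesis by (simp add: normal_monoid_def)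
qed

section \<open>Forced weights on odd cycles and irreducibility\<close>

text \<open>The vertex at position \<open>Suc j mod length vs\<close> is the common end of the edges
  at \<open>j\<close> and at that position. For a loop the two edges coincide, in accordance with
  its coefficient 2.\<close>

lemma sum_over_cycle_frags:
  fixes g :: "('a \<Rightarrow>\<^sub>0 int) \<Rightarrow> rat"
  assumes "distinct vs" "length vs \<noteq> 2" "j < length vs"
  shows "(\<Sum>e\<in>set (cycle_frags vs). g e * of_int (Poly_Mapping.lookup e (vs ! (Suc j mod length vs))))
    = g (cycle_frags vs ! j) + g (cycle_frags vs ! (Suc j mod length vs))"
proof -
  let ?k = "length vs" and ?cf = "cycle_frags vs"
  define m where "m = Suc j mod ?k"
  have m: "m < ?k" using assms(3) by (auto simp: m_def intro: mod_less_divisor)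
  have inj: "(Suc i mod ?k = m) = (i = j)" if "i < ?k" for i
    using that assms(3) by (auto simp: m_def mod_Suc split: if_splits)
  have lk: "Poly_Mapping.lookup (?cf ! i) (vs ! m) = (if i = m then 1 else 0) + (if i = j then 1 else 0)"
    if "i < ?k" for i
  proof -
    have "Suc i mod ?k < ?k" using that by (auto intro: mod_less_divisor)
    then have "(vs ! m = vs ! i) = (i = m)" "(vs ! m = vs ! (Suc i mod ?k)) = (i = j)"
      using assms(1) m that inj[OF that] by (auto simp: nth_eq_iff_index_eq)
    then show ?thesis by (simp add: cycle_frags_nth[OF that] lookup_add lookup_frag_of)
  qed
  have "(\<Sum>e\<in>set ?cf. g e * of_int (Poly_Mapping.lookup e (vs ! m)))
      = (\<Sum>i<?k. g (?cf ! i) * of_int (Poly_Mapping.lookup (?cf ! i) (vs ! m)))"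
    using bij_betw_nth[OF distinct_cycle_frags[OF assms(1,2)] refl refl]
    by (intro sum.reindex_bij_betw[symmetric]) (simp add: lessThan_atLeast0)
  also have "\<dots> = (\<Sum>i<?k. (if i = m then g (?cf ! i) else 0) + (if i = j then g (?cf ! i) else 0))"
    by (intro sum.cong) (auto simp: lk)
  also have "\<dots> = g (?cf ! j) + g (?cf ! m)"
    using m assms(3) by (simp add: sum.distrib)
  finally show ?thesis by (simp add: m_def)
qed

text \<open>Neighbouring weights sum to 1, so they alternate between a value and its complement;
  after an odd number of steps the value returns as its own complement.\<close>

lemma odd_cycle_coefficients_half:
  fixes g :: "('a \<Rightarrow>\<^sub>0 int) \<Rightarrow> rat"
  assumes "distinct vs" "odd (length vs)" "e \<in> set (cycle_frags vs)"
    and one: "\<And>v. v \<in> set vs \<Longrightarrow> (\<Sum>e\<in>set (cycle_frags vs). g e * of_int (Poly_Mapping.lookup e v)) = 1"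
  shows "g e = 1/2"
proof -
  let ?k = "length vs"
  \<comment> \<open>Positions are read modulo the length, so that the recursion can run once around
    the cycle and meet its start.\<close>
  define G where "G n = g (cycle_frags vs ! (n mod ?k))" for n
  have len: "?k \<noteq> 2" "0 < ?k" using assms(2) by (auto simp del: length_0_conv length_greater_0_conv intro: odd_pos)
  have step: "G n + G (Suc n) = 1" for n
  proof -
    have "n mod ?k < ?k" using len by simp
    from sum_over_cycle_frags[OF assms(1) len(1) this, of g] one[OF nth_mem] len(2)
    show ?thesis by (simp add: G_def mod_Suc_eq)
  qed
  have alt: "G n = (if even n then G 0 else 1 - G 0)" for n
  proof (induction n)
    case (Suc n)
    with step[of n] show ?case by (auto split: if_splits)
  qed simp
  have "G ?k = G 0" by (simp add: G_def)
  with alt[of ?k] assms(2) have "G 0 = 1/2" by simp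
  then have half: "G n = 1/2" for n using alt[of n] by (simp split: if_splits)
  obtain n where "n < ?k" "e = cycle_frags vs ! n"
    using assms(3) by (auto simp: in_set_conv_nth)
  then show ?thesis using half[of n] by (simp add: G_def)
qed

lemma exceptional_irreducible:
  assumes G: "finite_graph V E" and "h \<in> exceptional_elements E"
    and a: "a \<in> normal_monoid V E" and b: "b \<in> normal_monoid V E" and sum: "h = a + b"
  shows "a = 0 \<or> b = 0"
proof -
  let ?A = "edge_elements E"
  let ?l = "\<lambda>e v. rat_of_int (Poly_Mapping.lookup e v)"
  from assms(2) obtain vs ws where vw: "cycle E vs" "cycle E ws" "odd (length vs)" "odd (length ws)"
    "set vs \<inter> set ws = {}" "h = char_element (set vs \<union> set ws)"
    "{e \<in> E. e \<subseteq> set vs \<union> set ws} = set (cycle_edges vs) \<union> set (cycle_edges ws)"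
    by (elim exceptional_element_cases)
  have fin: "finite ?A" by (rule finite_edge_elements[OF G])
  define U where "U = set vs \<union> set ws"
  have l0: "0 \<le> ?l e v" if "e \<in> ?A" for e v
    using edge_elements_lookup_nonneg[OF that] by simp
  obtain c where c: "\<And>e. e \<in> ?A \<Longrightarrow> 0 \<le> c e" "\<And>v. ?l a v = (\<Sum>e\<in>?A. c e * ?l e v)"
    using a unfolding normal_monoid_def nonneg_rat_combination_def by blast
  obtain d where d: "\<And>e. e \<in> ?A \<Longrightarrow> 0 \<le> d e" "\<And>v. ?l b v = (\<Sum>e\<in>?A. d e * ?l e v)"
    using b unfolding normal_monoid_def nonneg_rat_combination_def by blast
  \<comment> \<open>The two representations add up to one of \<open>h\<close>; what is forced on
    \<open>g\<close> then has to be shared between \<open>c\<close> and \<open>d\<close>.\<close>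
  define g where "g e = c e + d e" for e
  have ab: "Poly_Mapping.lookup a v + Poly_Mapping.lookup b v = (if v \<in> U then 1 else 0)" for v
    using arg_cong[OF sum, of "\<lambda>f. Poly_Mapping.lookup f v"]
    by (simp add: vw(6) lookup_add lookup_char_element U_def)
  note nn = normal_monoid_nonneg[OF a] normal_monoid_nonneg[OF b]
  have gsum: "(\<Sum>e\<in>?A. g e * ?l e v) = (if v \<in> U then 1 else 0)" for v
  proof -
    have "(\<Sum>e\<in>?A. g e * ?l e v) = of_int (Poly_Mapping.lookup a v + Poly_Mapping.lookup b v)"
      by (simp add: g_def distrib_right sum.distrib c(2) d(2))
    then show ?thesis by (simp add: ab)
  qed
  have vanish: "q e = 0 \<or> ?l e v = 0"
    if "\<And>e. e \<in> ?A \<Longrightarrow> 0 \<le> q e" "(\<Sum>e\<in>?A. q e * ?l e v) = 0" "e \<in> ?A" for q e v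
    using sum_nonneg_eq_0_iff[OF fin, of "\<lambda>e. q e * ?l e v"] that l0 by (auto intro: mult_nonneg_nonneg)
  \<comment> \<open>An edge of nonzero weight has both ends in \<open>U\<close>, since
    \<open>h\<close> vanishes elsewhere. As the pair is induced, it is then an edge of one of the
    circuits.\<close>
  have supp: "e \<in> set (cycle_frags vs) \<union> set (cycle_frags ws)" if e: "e \<in> ?A" "g e \<noteq> 0" for e
  proof -
    obtain x y where xy: "{x, y} \<in> E" "e = frag_of x + frag_of y"
      using e(1) by (auto simp: edge_elements_def)
    have "Poly_Mapping.lookup e v = 0" if "v \<notin> U" for v
      using vanish[of g v e] e gsum[of v] that c(1) d(1) by (simp add: g_def)
    moreover have "Poly_Mapping.lookup e x \<noteq> 0" "Poly_Mapping.lookup e y \<noteq> 0"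
      by (simp_all add: xy(2) lookup_add lookup_frag_of)
    ultimately have "{x, y} \<subseteq> U" by blast
    then have "{x, y} \<in> set (cycle_edges vs) \<union> set (cycle_edges ws)"
      using xy(1) vw(7) unfolding U_def by blast
    then show ?thesis by (simp add: xy(2) cycle_frags_iff)
  qed
  have half: "g e = 1/2" if zs: "zs = vs \<or> zs = ws" and e: "e \<in> set (cycle_frags zs)" for zs e
  proof (rule odd_cycle_coefficients_half[OF _ _ e])
    show "distinct zs" "odd (length zs)" using zs vw by (auto simp: cycle_def)
    fix v assume v: "v \<in> set zs"
    have sub: "set (cycle_frags zs) \<subseteq> ?A" using zs cycle_frags_subset vw(1,2) by blast
    \<comment> \<open>Edges of the other circuit do not meet \<open>v\<close>, so the equation at
      \<open>v\<close> involves one circuit only.\<close>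
    have "g e * ?l e v = 0" if "e \<in> ?A - set (cycle_frags zs)" for e
    proof (cases "g e = 0")
      case False
      with that supp zs obtain us where "e \<in> set (cycle_frags us)" "v \<notin> set us"
        using v vw(5) by blast
      then have "v \<notin> Poly_Mapping.keys e" using keys_cycle_frags by blast
      then show ?thesis by (simp add: in_keys_iff)
    qed simp
    then have "(\<Sum>e\<in>set (cycle_frags zs). g e * ?l e v) = (\<Sum>e\<in>?A. g e * ?l e v)"
      by (intro sum.mono_neutral_left fin sub) auto
    also have "\<dots> = 1" using v zs by (auto simp: gsum U_def)
    finally show "(\<Sum>e\<in>set (cycle_frags zs). g e * ?l e v) = 1" .
  qed
  \<comment> \<open>If \<open>a\<close> were 1 at \<open>x\<close> and 0 at \<open>y\<close>, then
    \<open>c\<close> would vanish on the edge because of \<open>y\<close> and \<open>d\<close>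
    because of \<open>x\<close>, against their sum 1/2.\<close>
  have one: "Poly_Mapping.lookup a y = 1"
    if zs: "zs = vs \<or> zs = ws" and e: "frag_of x + frag_of y \<in> set (cycle_frags zs)"
      and ax: "Poly_Mapping.lookup a x = 1" for zs x y
  proof (rule ccontr)
    let ?e = "frag_of x + frag_of y"
    assume "Poly_Mapping.lookup a y \<noteq> 1"
    then have "Poly_Mapping.lookup a y = 0" "Poly_Mapping.lookup b x = 0"
      using ab[of y] ab[of x] nn[of y] nn[of x] ax by (auto split: if_splits)
    then have "(\<Sum>e\<in>?A. c e * ?l e y) = 0" "(\<Sum>e\<in>?A. d e * ?l e x) = 0"
      using c(2)[of y] d(2)[of x] by simp_all
    moreover have A: "?e \<in> ?A" using e zs cycle_frags_subset vw(1,2) by blast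
    moreover have "?l ?e x \<noteq> 0" "?l ?e y \<noteq> 0" by (simp_all add: lookup_add lookup_frag_of)
    ultimately have "c ?e = 0" "d ?e = 0"
      using vanish[of c y ?e] vanish[of d x ?e] c(1) d(1) by blast+
    then show False using half[OF zs e] by (simp add: g_def)
  qed
  have const: "Poly_Mapping.lookup a v = Poly_Mapping.lookup a (zs ! 0)"
    if zs: "zs = vs \<or> zs = ws" and v: "v \<in> set zs" for zs v
  proof -
    have "Poly_Mapping.lookup a (zs ! j) = Poly_Mapping.lookup a (zs ! 0)" if "j < length zs" for j
      using that
    proof (induction j)
      case (Suc j)
      then have "frag_of (zs ! j) + frag_of (zs ! Suc j) \<in> set (cycle_frags zs)"
        using cycle_frags_nth[of j zs] nth_mem[of j "cycle_frags zs"] by simp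
      from one[OF zs this] one[OF zs, of "zs ! Suc j" "zs ! j"] this
      have "Poly_Mapping.lookup a (zs ! j) = 1 \<longleftrightarrow> Poly_Mapping.lookup a (zs ! Suc j) = 1"
        by (auto simp: add.commute)
      moreover have "Poly_Mapping.lookup a u = 0 \<or> Poly_Mapping.lookup a u = 1" for u
        using ab[of u] nn[of u] by (auto split: if_splits)
      ultimately show ?case using Suc by (metis Suc_lessD)
    qed simp
    then show ?thesis using v by (metis in_set_conv_nth)
  qed
  have zero: "Poly_Mapping.lookup a v = 0" if "v \<notin> U" for v
    using ab[of v] nn[of v] that by simp
  define \<alpha> \<beta> where "\<alpha> = Poly_Mapping.lookup a (vs ! 0)" and "\<beta> = Poly_Mapping.lookup a (ws ! 0)"
  have UV: "U \<subseteq> V" "finite V"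
    using cycle_subset_vertices[OF G] vw(1,2) G by (auto simp: U_def finite_graph_def)
  \<comment> \<open>The total degree of \<open>a\<close> is even and both circuits are odd, so the
    constant values \<alpha> and \<beta> have the same parity; being 0 or 1, they agree.\<close>
  have "even (\<Sum>v\<in>V \<inter> UNIV. Poly_Mapping.lookup a v)"
    by (rule int_combination_even_on_closed[OF G]) (use a in \<open>auto simp: normal_monoid_def\<close>)
  also have "(\<Sum>v\<in>V \<inter> UNIV. Poly_Mapping.lookup a v) = (\<Sum>v\<in>U. Poly_Mapping.lookup a v)"
    using UV zero by (intro sum.mono_neutral_right) auto
  also have "\<dots> = (\<Sum>v\<in>set vs. \<alpha>) + (\<Sum>v\<in>set ws. \<beta>)"
    unfolding U_def using vw(5) const[of vs] const[of ws]
    by (simp add: sum.union_disjoint \<alpha>_def \<beta>_def del: sum_constant)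
  also have "\<dots> = int (length vs) * \<alpha> + int (length ws) * \<beta>"
    using vw(1,2) by (simp add: cycle_def distinct_card)
  finally have "even \<alpha> \<longleftrightarrow> even \<beta>" using vw(3,4) by simp
  moreover have "\<alpha> = 0 \<or> \<alpha> = 1" "\<beta> = 0 \<or> \<beta> = 1"
    unfolding \<alpha>_def \<beta>_def using ab nn by (smt (verit))+
  ultimately have "\<alpha> = \<beta>" by auto
  then have U\<alpha>: "Poly_Mapping.lookup a v = \<alpha>" if "v \<in> U" for v
    using that const[of vs] const[of ws] by (auto simp: U_def \<alpha>_def \<beta>_def)
  from \<open>\<alpha> = 0 \<or> \<alpha> = 1\<close> show ?thesis
  proof
    assume "\<alpha> = 0"
    with U\<alpha> zero have "Poly_Mapping.lookup a v = 0" for v by (cases "v \<in> U") auto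
    then have "a = 0" by (intro poly_mapping_eqI) simp
    then show ?thesis ..
  next
    assume "\<alpha> = 1"
    then have "Poly_Mapping.lookup b v = 0" for v
      using U\<alpha>[of v] zero[of v] ab[of v] by (cases "v \<in> U") auto
    then have "b = 0" by (intro poly_mapping_eqI) simp
    then show ?thesis ..
  qed
qed

text \<open>Degree 2 splits into two even nonnegative degrees, so one of them is 0, and a
  nonnegative element of degree 0 vanishes.\<close>

lemma edge_element_irreducible:
  assumes G: "finite_graph V E" and "h \<in> edge_elements E"
    and a: "a \<in> normal_monoid V E" and b: "b \<in> normal_monoid V E" and sum: "h = a + b"
  shows "a = 0 \<or> b = 0"
proof -
  define deg where "deg f = (\<Sum>v\<in>V. Poly_Mapping.lookup f v)" for f :: "'a \<Rightarrow>\<^sub>0 int"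
  have fin: "finite V" using G by (simp add: finite_graph_def)
  have even: "even (deg f)" if "f \<in> normal_monoid V E" for f
    using int_combination_even_on_closed[OF G, of f UNIV] that by (simp add: normal_monoid_def deg_def)
  have pos: "0 \<le> deg f" if "f \<in> normal_monoid V E" for f
    using normal_monoid_nonneg[OF that] by (simp add: deg_def sum_nonneg)
  have zero: "f = 0" if f: "f \<in> normal_monoid V E" "deg f = 0" for f
  proof -
    have "\<forall>v\<in>V. Poly_Mapping.lookup f v = 0"
      using f normal_monoid_nonneg[OF f(1)] sum_nonneg_eq_0_iff[OF fin] unfolding deg_def by blast
    moreover have "Poly_Mapping.keys f \<subseteq> V" using f(1) by (simp add: normal_monoid_def)
    ultimately have "Poly_Mapping.lookup f v = 0" for v by (cases "v \<in> V") (auto simp: in_keys_iff subset_iff)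
    then show "f = 0" by (intro poly_mapping_eqI) simp
  qed
  obtain x y where xy: "{x, y} \<in> E" "h = frag_of x + frag_of y"
    using assms(2) by (auto simp: edge_elements_def)
  then have "{x, y} \<subseteq> V" using G unfolding finite_graph_def by blast
  then have "deg a + deg b = 2"
    using fin xy(2) unfolding sum[symmetric] deg_def
    by (simp add: sum deg_def flip: sum.distrib lookup_add) (simp add: lookup_add lookup_frag_of sum.distrib)
  then have "deg a = 0 \<or> deg b = 0"
    using even[OF a] even[OF b] pos[OF a] pos[OF b] by presburger
  then show ?thesis using zero a b by blast
qed

subsection \<open>Decomposition into cycles\<close>

lemma edge_element_at_vertex:
  assumes "a \<in> edge_elements E" "Poly_Mapping.lookup a z \<noteq> 0"
  obtains w where "a = frag_of z + frag_of w"
proof -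
  obtain x y where "a = frag_of x + frag_of y" using assms(1) by (auto simp: edge_elements_def)
  with assms(2) that[of x] that[of y] show thesis
    by (auto simp: lookup_add lookup_frag_of add.commute split: if_splits)
qed

text \<open>The last neighbour on a longest path closes up a cycle.\<close>

lemma exists_cycle_if_degree_ge_2:
  assumes "finite F" "F \<subseteq> edge_elements E" "finite W" "W \<noteq> {}"
    and keys: "\<And>a. a \<in> F \<Longrightarrow> Poly_Mapping.keys a \<subseteq> W"
    and deg: "\<And>v. v \<in> W \<Longrightarrow> 2 \<le> (\<Sum>a\<in>F. Poly_Mapping.lookup a v)"
  obtains vs where "cycle E vs" "set vs \<subseteq> W" "set (cycle_frags vs) \<subseteq> F" "length vs \<noteq> 2"
proof -
  define EF where "EF = {{x, y} | x y. frag_of x + frag_of y \<in> F}"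
  have EF: "{x, y} \<in> EF \<longleftrightarrow> frag_of x + frag_of y \<in> F" for x y
    unfolding EF_def by (auto simp: doubleton_eq_iff add.commute)
  have "EF \<subseteq> E"
    using assms(2) by (auto simp: EF_def edge_elements_iff subset_iff)
  have W: "w \<in> W" if "frag_of z + frag_of w \<in> F" for z w
    using keys[OF that] by (auto simp: in_keys_iff lookup_add lookup_frag_of subset_iff)
  define path where "path vs \<longleftrightarrow> vs \<noteq> [] \<and> distinct vs \<and> set vs \<subseteq> W \<and> set (walk_edges vs) \<subseteq> EF" for vs
  obtain w0 where "w0 \<in> W" using assms(4) by blast
  then have "path [w0]" by (simp add: path_def)
  moreover have "length vs \<le> card W" if "path vs" for vs
    using that card_mono[OF assms(3), of "set vs"] by (simp add: path_def distinct_card)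
  ultimately have "\<exists>vs. path vs \<and> (\<forall>us. path us \<longrightarrow> length us \<le> length vs)"
    by (intro ex_has_greatest_nat[of path "[w0]" length "Suc (card W)"]) (auto simp: less_Suc_eq_le)
  then obtain vs where vs: "path vs" "\<And>us. path us \<Longrightarrow> length us \<le> length vs"
    by blast
  \<comment> \<open>Paths are extended at the head \<open>z\<close>; by maximality all neighbours of
    \<open>z\<close> already lie on the path.\<close>
  then obtain z r where zr: "vs = z # r" by (cases vs) (auto simp: path_def)
  have nb: "w \<in> set vs" if "frag_of z + frag_of w \<in> F" for w
  proof (rule ccontr)
    assume "w \<notin> set vs"
    then have "path (w # vs)"
      using vs(1) W[OF that] that by (auto simp: path_def zr EF add.commute)
    from vs(2)[OF this] show False by simp
  qed
  have nn: "0 \<le> Poly_Mapping.lookup a v" if "a \<in> F" for a v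
    by (rule edge_elements_lookup_nonneg[OF subsetD[OF assms(2) that]])
  have degz: "2 \<le> (\<Sum>a\<in>F. Poly_Mapping.lookup a z)"
    using deg vs(1) by (simp add: path_def zr)
  have "\<exists>us. cycle EF us \<and> set us \<subseteq> W \<and> length us \<noteq> 2"
  proof (cases "frag_of z + frag_of z \<in> F")
    case True
    then show ?thesis
      using vs(1) by (intro exI[of _ "[z]"]) (use EF[of z z] in \<open>auto simp: cycle_def cycle_edges_Cons path_def zr\<close>)
  next
    case False
    obtain a where a: "a \<in> F" "Poly_Mapping.lookup a z \<noteq> 0"
      using degz sum.neutral[of F "\<lambda>a. Poly_Mapping.lookup a z"] by fastforce
    obtain x where x: "a = frag_of z + frag_of x"
      by (rule edge_element_at_vertex[OF subsetD[OF assms(2) a(1)] a(2)])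
    have "x \<in> set vs" "x \<noteq> z" using nb[of x] a(1) False unfolding x by auto
    then have "r \<noteq> []" by (auto simp: zr)
    then obtain y r' where r: "r = y # r'" by (cases r) auto
    define e where "e = frag_of z + frag_of y"
    have e: "e \<in> F" "Poly_Mapping.lookup e z = 1"
      using vs(1) by (auto simp: path_def zr r e_def EF lookup_add lookup_frag_of)
    \<comment> \<open>The edge \<open>e\<close> to the next vertex \<open>y\<close> uses only 1 of
      the degree at \<open>z\<close>, so a second edge leaves \<open>z\<close>. It ends beyond
      \<open>y\<close> on the path, which gives a cycle of length at least 3.\<close>
    then have "1 \<le> (\<Sum>a\<in>F - {e}. Poly_Mapping.lookup a z)"
      using degz by (simp add: sum.remove[OF assms(1) e(1)])
    then obtain b where b: "b \<in> F - {e}" "Poly_Mapping.lookup b z \<noteq> 0"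
      using sum.neutral[of "F - {e}" "\<lambda>a. Poly_Mapping.lookup a z"] by fastforce
    obtain w where w: "b = frag_of z + frag_of w"
      by (rule edge_element_at_vertex[OF subsetD[OF assms(2)] b(2)]) (use b(1) in blast)
    have "w \<in> set r'"
      using nb[of w] b w False by (auto simp: zr r e_def)
    then obtain s t where st: "r' = s @ w # t" using split_list by fast
    have "set (walk_edges ((z # y # s) @ [w])) \<subseteq> EF"
      using vs(1) walk_edges_sublist[of "z # y # s @ [w]" "[]" t] by (auto simp: path_def zr r st)
    moreover have "{w, z} \<in> EF" using b w by (simp add: EF add.commute)
    ultimately have "cycle EF (z # y # s @ [w])"
      using vs(1) walk_edges_append[of "z # y # s" w "[z]"]
      by (auto simp: cycle_def cycle_edges_Cons path_def zr r st)
    moreover have "set (z # y # s @ [w]) \<subseteq> W" using vs(1) by (auto simp: path_def zr r st)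
    ultimately show ?thesis by (intro exI[of _ "z # y # s @ [w]"]) simp
  qed
  then obtain us where us: "cycle EF us" "set us \<subseteq> W" "length us \<noteq> 2" by blast
  have "set (cycle_frags us) \<subseteq> F"
  proof
    fix a assume a: "a \<in> set (cycle_frags us)"
    then obtain x y where xy: "a = frag_of x + frag_of y" by (auto simp: cycle_frags_def)
    with a have "{x, y} \<in> EF" using us(1) by (auto simp: cycle_def cycle_frags_iff)
    with xy show "a \<in> F" by (simp add: EF)
  qed
  moreover have "cycle E us" using us(1) \<open>EF \<subseteq> E\<close> by (auto simp: cycle_def)
  ultimately show thesis using that us by blast
qed

text \<open>A cycle of length other than 2 uses up the full degree of its vertices. The remaining
  edges therefore avoid it and are again 2-regular on the remaining vertices.\<close>

lemma two_regular_cycle_decomposition: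
  assumes "finite F" "F \<subseteq> edge_elements E" "finite W"
    "\<And>a. a \<in> F \<Longrightarrow> Poly_Mapping.keys a \<subseteq> W"
    "\<And>v. v \<in> W \<Longrightarrow> (\<Sum>a\<in>F. Poly_Mapping.lookup a v) = 2"
  shows "\<exists>P. finite P \<and> (\<forall>p\<in>P. cycle E p) \<and> pairwise (\<lambda>p q. set p \<inter> set q = {}) P
    \<and> (\<Union>p\<in>P. set p) = W"
  using assms(3,1,2,4,5)
proof (induction W arbitrary: F rule: finite_psubset_induct)
  case (psubset W)
  show ?case
  proof (cases "W = {}")
    case True
    then show ?thesis by (intro exI[of _ "{}"]) simp
  next
    case False
    obtain vs where vs: "cycle E vs" "set vs \<subseteq> W" "set (cycle_frags vs) \<subseteq> F" "length vs \<noteq> 2"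
      using exists_cycle_if_degree_ge_2[of F E W] psubset.hyps psubset.prems False by (metis order_refl)
    define F' where "F' = F - set (cycle_frags vs)"
    have ne: "set vs \<noteq> {}" and dist: "distinct vs" using vs(1) by (auto simp: cycle_def)
    have sum: "(\<Sum>a\<in>F'. Poly_Mapping.lookup a v) = (if v \<in> set vs then 0 else 2)" if "v \<in> W" for v
    proof -
      have "(\<Sum>a\<in>F. Poly_Mapping.lookup a v) = (\<Sum>a\<in>F'. Poly_Mapping.lookup a v)
          + Poly_Mapping.lookup (\<Sum>(set (cycle_frags vs))) v"
        unfolding F'_def lookup_sum using vs(3) psubset.prems(1) by (rule sum.subset_diff)
      then show ?thesis
        using psubset.prems(4)[OF that] by (simp add: sum_cycle_frags[OF dist vs(4)] lookup_char_element split: if_splits)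
    qed
    have "Poly_Mapping.keys a \<subseteq> W - set vs" if a: "a \<in> F'" for a
    proof -
      have "Poly_Mapping.lookup a v = 0" if v: "v \<in> set vs" for v
      proof -
        have "(\<Sum>a\<in>F'. Poly_Mapping.lookup a v) = 0" using sum[of v] v vs(2) by auto
        moreover have "\<forall>b\<in>F'. 0 \<le> Poly_Mapping.lookup b v"
          using psubset.prems(2) unfolding F'_def by (meson DiffD1 edge_elements_lookup_nonneg subsetD)
        ultimately show ?thesis
          using a psubset.prems(1) sum_nonneg_eq_0_iff[of F' "\<lambda>b. Poly_Mapping.lookup b v"]
          by (simp add: F'_def)
      qed
      then show ?thesis using psubset.prems(3)[of a] a by (auto simp: F'_def in_keys_iff)
    qed
    moreover have "W - set vs \<subset> W" 
    proof
      show "W - set vs \<noteq> W" using vs(2) ne by (metis Diff_disjoint Int_absorb2 Int_commute)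
    qed simp
    moreover have "finite F'" "F' \<subseteq> edge_elements E" using psubset.prems(1,2) by (auto simp: F'_def)
    ultimately have "\<exists>P. finite P \<and> (\<forall>p\<in>P. cycle E p) \<and> pairwise (\<lambda>p q. set p \<inter> set q = {}) P
      \<and> (\<Union>p\<in>P. set p) = W - set vs"
      using sum by (intro psubset.IH[of "W - set vs" F']) auto
    then obtain P where P: "finite P" "\<forall>p\<in>P. cycle E p" "pairwise (\<lambda>p q. set p \<inter> set q = {}) P"
      "(\<Union>p\<in>P. set p) = W - set vs"
      by blast
    then show ?thesis
      using vs(1,2) by (intro exI[of _ "insert vs P"]) (auto simp: pairwise_insert)
  qed
qed

text \<open>Parity lets the odd cycles be matched up in pairs inside the connected components.\<close>

lemma odd_cycles_in_hull:
  assumes "finite_graph V E" "finite P" "\<And>p. p \<in> P \<Longrightarrow> cycle E p \<and> odd (length p)"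
    "pairwise (\<lambda>p q. set p \<inter> set q = {}) P" "\<And>u. even (card {p \<in> P. (u, hd p) \<in> conn E})"
  shows "(\<Sum>p\<in>P. char_element (set p)) \<in> add_submonoid hull (edge_elements E \<union> exceptional_elements E)"
  using assms(2-)
proof (induction P rule: finite_psubset_induct)
  case (psubset P)
  show ?case
  proof (cases "P = {}")
    case True
    then show ?thesis by (simp add: hull_zero)
  next
    case False
    then obtain p where p: "p \<in> P" by blast
    have "(hd p, hd p) \<in> conn E" by (simp add: conn_def)
    \<comment> \<open>The cycles in the component of \<open>p\<close> are even in number and include
      \<open>p\<close>, so there is another one.\<close>
    moreover have "{q \<in> P. (hd p, hd q) \<in> conn E} \<noteq> {p}"
      using psubset.prems(3)[of "hd p"] by force
    ultimately obtain q where q: "q \<in> P" "q \<noteq> p" "(hd p, hd q) \<in> conn E"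
      using p by blast
    define P' where "P' = P - {p, q}"
    have pq: "cycle E p" "cycle E q" "odd (length p)" "odd (length q)"
      using psubset.prems(1) p q(1) by blast+
    then have hd: "hd p \<in> set p" "hd q \<in> set q" by (auto simp: cycle_def)
    have "even (card {r \<in> P'. (u, hd r) \<in> conn E})" for u
    proof -
      let ?K = "\<lambda>X. {r \<in> X. (u, hd r) \<in> conn E}"
      have "(u, hd p) \<in> conn E \<longleftrightarrow> (u, hd q) \<in> conn E"
        using q(3) conn_sym[OF q(3)] conn_trans[of u "hd p" E "hd q"] conn_trans[of u "hd q" E "hd p"]
        by blast
      then have "?K {p, q} = (if (u, hd p) \<in> conn E then {p, q} else {})" by auto
      then have "even (card (?K {p, q}))" using q(2) by simp
      moreover have "card (?K P) = card (?K P') + card (?K {p, q})"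
        using psubset.hyps p q(1) by (subst card_Un_disjoint[symmetric]) (auto simp: P'_def intro: arg_cong[of _ _ card])
      ultimately show ?thesis using psubset.prems(3)[of u] by simp
    qed
    moreover have "pairwise (\<lambda>p q. set p \<inter> set q = {}) P'"
      using psubset.prems(2) by (rule pairwise_subset) (simp add: P'_def)
    ultimately have "(\<Sum>p\<in>P'. char_element (set p)) \<in> add_submonoid hull (edge_elements E \<union> exceptional_elements E)"
      using p psubset.prems(1) by (intro psubset.IH) (auto simp: P'_def)
    moreover have "char_element (set p) + char_element (set q)
        \<in> add_submonoid hull (edge_elements E \<union> exceptional_elements E)"
    proof (rule odd_cycle_pair_in_hull[OF assms(1) pq])
      show "set p \<inter> set q = {}" using psubset.prems(2) p q(1,2) by (auto simp: pairwise_def)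
      show "(u, w) \<in> conn E" if "u \<in> set p" "w \<in> set q" for u w
        using cycle_conn[OF pq(1) that(1) hd(1)] cycle_conn[OF pq(2) hd(2) that(2)] q(3) conn_trans
        by metis
    qed
    moreover have "(\<Sum>p\<in>P. char_element (set p))
        = char_element (set p) + char_element (set q) + (\<Sum>p\<in>P'. char_element (set p))"
      using psubset.hyps p q(1,2) sum.subset_diff[of "{p, q}" P "\<lambda>p. char_element (set p)"]
      by (simp add: P'_def algebra_simps)
    ultimately show ?thesis using hull_add by metis
  qed
qed

text \<open>Over a component \<open>K\<close> the coefficients sum to the number of vertices of the
  cycles in \<open>K\<close>. Integrality makes this even, hence also the number of odd cycles in
  \<open>K\<close>, as the pairing requires.\<close>

lemma disjoint_cycles_in_hull:
  assumes G: "finite_graph V E" and P: "finite P" "\<And>p. p \<in> P \<Longrightarrow> cycle E p"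
    "pairwise (\<lambda>p q. set p \<inter> set q = {}) P"
    and V: "\<And>p. p \<in> P \<Longrightarrow> set p \<subseteq> V"
    and int: "int_combination (edge_elements E) (\<Sum>p\<in>P. char_element (set p))"
  shows "(\<Sum>p\<in>P. char_element (set p)) \<in> add_submonoid hull (edge_elements E \<union> exceptional_elements E)"
proof -
  let ?H = "add_submonoid hull (edge_elements E \<union> exceptional_elements E)"
  define Q where "Q = {p \<in> P. odd (length p)}"
  have "even (card {p \<in> Q. (u, hd p) \<in> conn E})" for u
  proof -
    define K where "K = {v. (u, v) \<in> conn E}"
    have K: "v \<in> K \<longleftrightarrow> w \<in> K" if "(v, w) \<in> conn E" for v w
      using that conn_sym conn_trans unfolding K_def mem_Collect_eq by metis
    have "(\<Sum>v\<in>V \<inter> K. Poly_Mapping.lookup (char_element (set p)) v)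
        = int (if hd p \<in> K then length p else 0)" if p: "p \<in> P" for p
    proof -
      have "distinct p" "p \<noteq> []" using P(2)[OF p] by (auto simp: cycle_def)
      have "(\<Sum>v\<in>V \<inter> K. Poly_Mapping.lookup (char_element (set p)) v) = int (card (V \<inter> K \<inter> set p))"
        using G by (simp add: lookup_char_element finite_graph_def sum.inter_filter[symmetric] Int_def)
      \<comment> \<open>A cycle is connected, so it lies in \<open>K\<close> entirely or not at all,
        and its first vertex decides.\<close>
      also have "V \<inter> K \<inter> set p = (if hd p \<in> K then set p else {})"
        using V[OF p] K[OF cycle_conn[OF P(2)[OF p] hd_in_set[OF \<open>p \<noteq> []\<close>]]] by auto
      finally show ?thesis using \<open>distinct p\<close> by (simp add: distinct_card)
    qed
    then have eq: "(\<Sum>v\<in>V \<inter> K. Poly_Mapping.lookup (\<Sum>p\<in>P. char_element (set p)) v)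
        = int (\<Sum>p\<in>P. if hd p \<in> K then length p else 0)"
      unfolding lookup_sum by (subst sum.swap) simp
    have "v \<in> K \<longleftrightarrow> w \<in> K" if "{v, w} \<in> E" for v w
      using K that by (simp add: conn_def r_into_rtrancl)
    then have "even (\<Sum>v\<in>V \<inter> K. Poly_Mapping.lookup (\<Sum>p\<in>P. char_element (set p)) v)"
      by (rule int_combination_even_on_closed[OF G int])
    then have "even (\<Sum>p\<in>P. if hd p \<in> K then length p else 0)"
      unfolding eq even_of_nat_iff .
    then have "even (card {p \<in> P. odd (if hd p \<in> K then length p else 0)})"
      using P(1) by (simp add: even_sum_iff)
    also have "{p \<in> P. odd (if hd p \<in> K then length p else 0)} = {p \<in> Q. (u, hd p) \<in> conn E}"
      by (auto simp: Q_def K_def split: if_splits)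
    finally show ?thesis .
  qed
  then have "(\<Sum>p\<in>Q. char_element (set p)) \<in> ?H"
    using P by (intro odd_cycles_in_hull[OF G]) (auto simp: Q_def intro: pairwise_subset)
  moreover have "(\<Sum>p\<in>R. char_element (set p)) \<in> ?H" if "R \<subseteq> P - Q" for R
    using finite_subset[OF that finite_Diff[OF P(1)]] that
  proof (induction R rule: finite_induct)
    case (insert p R)
    then have "char_element (set p) \<in> add_submonoid hull (edge_elements E)"
      using P(2) by (intro even_cycle_in_hull) (auto simp: Q_def)
    then have "char_element (set p) \<in> ?H" by (meson Un_upper1 hull_mono subsetD)
    with insert show ?case by (simp add: hull_add)
  qed (simp add: hull_zero)
  moreover have "(\<Sum>p\<in>P. char_element (set p))
      = (\<Sum>p\<in>P - Q. char_element (set p)) + (\<Sum>p\<in>Q. char_element (set p))"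
    using P(1) by (intro sum.subset_diff) (auto simp: Q_def)
  ultimately show ?thesis using hull_add by (metis order_refl)
qed

subsection \<open>Generation\<close>

text \<open>From the interior point \<open>c\<close> of the orthant, the line in direction
  \<open>d\<close> leaves the orthant on at least one side; \<open>t\<close> marks the first contact
  with the boundary.\<close>

lemma nonneg_shift_to_boundary:
  fixes c d :: "'b \<Rightarrow> 'k::linordered_field"
  assumes "finite F" "\<And>a. a \<in> F \<Longrightarrow> 0 < c a" "a0 \<in> F" "d a0 \<noteq> 0"
  shows "\<exists>t. (\<forall>a\<in>F. 0 \<le> c a - t * d a) \<and> (\<exists>a\<in>F. c a - t * d a = 0)"
proof -
  have pos: "\<exists>t. (\<forall>a\<in>F. 0 \<le> c a - t * d a) \<and> (\<exists>a\<in>F. c a - t * d a = 0)"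
    if "0 < d a0" for d :: "'b \<Rightarrow> 'k"
  proof -
    \<comment> \<open>Only coefficients with positive \<open>d a\<close> decrease, and each reaches
      0 at its ratio; the least ratio is the first contact.\<close>
    define T where "T = (\<lambda>a. c a / d a) ` {a \<in> F. 0 < d a}"
    have T: "finite T" "T \<noteq> {}" using assms(1,3) that by (auto simp: T_def)
    have "Min T \<in> T" using T by (rule Min_in)
    then have "\<exists>b\<in>{a \<in> F. 0 < d a}. Min T = c b / d b" by (simp only: T_def image_iff)
    then obtain b where b: "b \<in> F" "0 < d b" "Min T = c b / d b" by blast
    have "0 \<le> c a - Min T * d a" if a: "a \<in> F" for a
    proof (cases "0 < d a")
      case True
      then have "Min T \<le> c a / d a" using a T(1) by (auto simp: T_def)
      with True show ?thesis by (simp add: field_simps)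
    next
      case False
      have "0 \<le> Min T" using b assms(2)[OF b(1)] by simp
      with False have "Min T * d a \<le> 0" by (simp add: mult_nonneg_nonpos)
      with assms(2)[OF a] show ?thesis by linarith
    qed
    moreover have "c b - Min T * d b = 0" using b by simp
    ultimately show ?thesis using b(1) by blast
  qed
  show ?thesis
  proof (cases "0 < d a0")
    case False
    then obtain t where "\<forall>a\<in>F. 0 \<le> c a - t * (- d a)" "\<exists>a\<in>F. c a - t * (- d a) = 0"
      using pos[of "\<lambda>a. - d a"] assms(4) by auto
    then show ?thesis by (intro exI[of _ "- t"]) simp
  qed (rule pos)
qed

text \<open>Caratheodory's argument: a linear relation on the support could be subtracted from
  \<open>c\<close> until some coefficient reaches 0, which keeps the represented vector and shrinks
  the support.\<close>

lemma minimal_support_independent: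
  fixes c d :: "'b \<Rightarrow> 'k::linordered_field"
  assumes "finite A" and nonneg: "\<And>a. a \<in> A \<Longrightarrow> 0 \<le> c a"
    and min: "\<And>c'. (\<And>a. a \<in> A \<Longrightarrow> 0 \<le> c' a) \<Longrightarrow> (\<And>v. (\<Sum>a\<in>A. c' a * m a v) = (\<Sum>a\<in>A. c a * m a v))
      \<Longrightarrow> card {a \<in> A. c a \<noteq> 0} \<le> card {a \<in> A. c' a \<noteq> 0}"
    and d: "\<And>v. (\<Sum>a | a \<in> A \<and> c a \<noteq> 0. d a * m a v) = 0" and a0: "a0 \<in> A" "c a0 \<noteq> 0"
  shows "d a0 = 0"
proof (rule ccontr)
  assume "d a0 \<noteq> 0"
  define F where "F = {a \<in> A. c a \<noteq> 0}"
  have F: "finite F" "F \<subseteq> A" "a0 \<in> F" using assms(1) a0 by (auto simp: F_def)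
  have "0 < c a" if "a \<in> F" for a using nonneg[of a] that by (auto simp: F_def)
  then obtain t where t: "\<And>a. a \<in> F \<Longrightarrow> 0 \<le> c a - t * d a" "\<exists>a\<in>F. c a - t * d a = 0"
    using nonneg_shift_to_boundary[of F c a0 d] F(1,3) \<open>d a0 \<noteq> 0\<close> by blast
  define c' where "c' a = (if a \<in> F then c a - t * d a else 0)" for a
  have "(\<Sum>a\<in>A. c' a * m a v) = (\<Sum>a\<in>A. c a * m a v)" for v
  proof -
    have "(\<Sum>a\<in>A. c' a * m a v) = (\<Sum>a\<in>F. (c a - t * d a) * m a v)"
      using F assms(1) by (intro sum.mono_neutral_cong_right) (auto simp: c'_def)
    also have "\<dots> = (\<Sum>a\<in>F. c a * m a v) - t * (\<Sum>a\<in>F. d a * m a v)"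
      by (simp add: left_diff_distrib sum_subtractf sum_distrib_left mult.assoc)
    also have "\<dots> = (\<Sum>a\<in>F. c a * m a v)" using d[of v] by (simp add: F_def)
    also have "\<dots> = (\<Sum>a\<in>A. c a * m a v)"
      using F assms(1) by (intro sum.mono_neutral_left) (auto simp: F_def)
    finally show ?thesis .
  qed
  then have "card F \<le> card {a \<in> A. c' a \<noteq> 0}"
    unfolding F_def using t(1) by (intro min) (auto simp: c'_def)
  moreover have "{a \<in> A. c' a \<noteq> 0} \<subset> F" using t(2) F(2) by (auto simp: c'_def split: if_splits)
  then have "card {a \<in> A. c' a \<noteq> 0} < card F" using F(1) by (rule psubset_card_mono[rotated])
  ultimately show False by simp
qed

lemma sum_lookup_edge_element:
  assumes "finite W" "a \<in> edge_elements E" "Poly_Mapping.keys a \<subseteq> W"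
  shows "(\<Sum>v\<in>W. Poly_Mapping.lookup a v) = 2"
proof -
  obtain x y where xy: "a = frag_of x + frag_of y" using assms(2) by (auto simp: edge_elements_def)
  then have "x \<in> Poly_Mapping.keys a" "y \<in> Poly_Mapping.keys a"
    by (simp_all add: in_keys_iff lookup_add lookup_frag_of)
  then have "x \<in> W" "y \<in> W" using assms(3) by blast+
  then show ?thesis using assms(1) by (simp add: xy lookup_add lookup_frag_of sum.distrib)
qed

text \<open>If no edge can be split off, a representation of minimal support has all its coefficients
  strictly between 0 and 1. By linear independence it has at most as many edges as vertices, and by
  integrality no vertex has degree 1. Hence its support is 2-regular and the element is the
  characteristic function of its vertex set.\<close>

lemma normal_monoid_reduced_in_hull:
  assumes G: "finite_graph V E" and f: "f \<in> normal_monoid V E"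
    and red: "\<And>a. a \<in> edge_elements E \<Longrightarrow> f - a \<notin> normal_monoid V E"
  shows "f \<in> add_submonoid hull (edge_elements E \<union> exceptional_elements E)"
proof -
  let ?A = "edge_elements E"
  let ?l = "\<lambda>a v. rat_of_int (Poly_Mapping.lookup a v)"
  have fin: "finite ?A" by (rule finite_edge_elements[OF G])
  have nn: "0 \<le> Poly_Mapping.lookup a v" if "a \<in> ?A" for a v
    using that by (rule edge_elements_lookup_nonneg)
  define rep where "rep c \<longleftrightarrow> (\<forall>a\<in>?A. 0 \<le> c a) \<and> (\<forall>v. ?l f v = (\<Sum>a\<in>?A. c a * ?l a v))" for c
  have "\<exists>c. rep c" using f by (simp add: normal_monoid_def nonneg_rat_combination_def rep_def)
  then obtain c where c: "rep c"
    and min: "\<And>c'. rep c' \<Longrightarrow> card {a \<in> ?A. c a \<noteq> 0} \<le> card {a \<in> ?A. c' a \<noteq> 0}"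
    using ex_has_least_nat[of rep _ "\<lambda>c. card {a \<in> ?A. c a \<noteq> 0}"] by blast
  define F where "F = {a \<in> ?A. c a \<noteq> 0}"
  have F: "finite F" "F \<subseteq> ?A" using fin by (auto simp: F_def)
  have fsum: "?l f v = (\<Sum>a\<in>F. c a * ?l a v)" for v
    using c fin by (simp add: rep_def F_def) (intro sum.mono_neutral_right, auto)
  have c0: "0 < c a" if "a \<in> F" for a
    using that c by (auto simp: F_def rep_def order_less_le)
  have fV: "Poly_Mapping.keys f \<subseteq> V" "int_combination ?A f"
    using f by (auto simp: normal_monoid_def)
  \<comment> \<open>A weight of at least 1 stays nonnegative when the edge is subtracted once, and
    integrality survives too; so the edge could be split off.\<close>
  have c1: "c a < 1" if a: "a \<in> F" for a
  proof (rule ccontr)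
    assume "\<not> c a < 1"
    have aA: "a \<in> ?A" using a F by blast
    have "a \<in> normal_monoid V E" using G aA by (rule edge_element_in_normal_monoid)
    then have "Poly_Mapping.keys (f - a) \<subseteq> V" "int_combination ?A (f - a)"
      using keys_diff[of f a] fV by (auto simp: normal_monoid_def int_combination_diff)
    moreover have "nonneg_rat_combination ?A (f - a)"
      unfolding nonneg_rat_combination_def
    proof (intro exI[of _ "c(a := c a - 1)"] conjI ballI allI)
      fix v
      have "(\<Sum>b\<in>?A. (c(a := c a - 1)) b * ?l b v)
          = (\<Sum>b\<in>?A. c b * ?l b v) - ?l a v"
        using fin aA by (simp add: sum.remove[OF fin aA] algebra_simps)
      then show "?l (f - a) v = (\<Sum>b\<in>?A. (c(a := c a - 1)) b * ?l b v)"
        using c by (simp add: rep_def lookup_minus)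
    qed (use c \<open>\<not> c a < 1\<close> in \<open>auto simp: rep_def\<close>)
    ultimately have "f - a \<in> normal_monoid V E" by (simp add: normal_monoid_def)
    with red[OF aA] show False ..
  qed
  define W where "W = (\<Union>a\<in>F. Poly_Mapping.keys a)"
  have W: "finite W" "\<And>a. a \<in> F \<Longrightarrow> Poly_Mapping.keys a \<subseteq> W" using F(1) by (auto simp: W_def)
  have "card F \<le> card W"
  proof (rule ccontr)
    assume "\<not> card F \<le> card W"
    then obtain d where d: "\<exists>a\<in>F. d a \<noteq> 0" "\<forall>v\<in>W. (\<Sum>a\<in>F. d a * ?l a v) = 0"
      using homogeneous_system_nontrivial_solution[OF W(1) F(1), of ?l] by auto
    have "(\<Sum>a\<in>F. d a * ?l a v) = 0" for v
    proof (cases "v \<in> W")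
      case False
      then have "?l a v = 0" if "a \<in> F" for a using W(2)[OF that] by (auto simp: in_keys_iff)
      then show ?thesis by (intro sum.neutral) simp
    qed (use d in blast)
    then have "d a = 0" if "a \<in> F" for a
      using minimal_support_independent[of ?A c ?l d a] fin c min that unfolding rep_def F_def by simp
    with d(1) show False by blast
  qed
  \<comment> \<open>The degree in the support, a loop counting twice. Degree 1 thus means a single
    edge that is no loop, whose weight would be the integer coefficient of \<open>f\<close>.\<close>
  define D where "D v = (\<Sum>a\<in>F. Poly_Mapping.lookup a v)" for v
  have D2: "2 \<le> D v" if v: "v \<in> W" for v
  proof (rule ccontr)
    assume "\<not> 2 \<le> D v"
    obtain a where a: "a \<in> F" "Poly_Mapping.lookup a v \<noteq> 0"
      using v by (auto simp: W_def in_keys_iff)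
    have "D v = Poly_Mapping.lookup a v + (\<Sum>b\<in>F - {a}. Poly_Mapping.lookup b v)"
      unfolding D_def by (rule sum.remove[OF F(1) a(1)])
    moreover have "0 \<le> (\<Sum>b\<in>F - {a}. Poly_Mapping.lookup b v)"
      using F(2) nn by (intro sum_nonneg) auto
    moreover have "0 < Poly_Mapping.lookup a v"
      using nn[of a v] a F(2) by force
    ultimately have one: "Poly_Mapping.lookup a v = 1" "(\<Sum>b\<in>F - {a}. Poly_Mapping.lookup b v) = 0"
      using \<open>\<not> 2 \<le> D v\<close> by linarith+
    then have "\<forall>b\<in>F - {a}. Poly_Mapping.lookup b v = 0"
      using F nn by (subst (asm) sum_nonneg_eq_0_iff) auto
    then have "(\<Sum>b\<in>F - {a}. c b * ?l b v) = 0" by (intro sum.neutral) simp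
    then have "?l f v = c a"
      unfolding fsum by (simp add: sum.remove[OF F(1) a(1)] one)
    then have "0 < ?l f v" "?l f v < 1" using c0[OF a(1)] c1[OF a(1)] by simp_all
    then show False by simp
  qed
  \<comment> \<open>Double counting: the degrees sum to \<open>2 * card F\<close>, at most
    \<open>2 * card W\<close>, while each is at least 2; so each equals 2.\<close>
  have "(\<Sum>v\<in>W. D v) = (\<Sum>a\<in>F. \<Sum>v\<in>W. Poly_Mapping.lookup a v)"
    unfolding D_def by (rule sum.swap)
  also have "\<dots> = (\<Sum>a\<in>F. 2)"
    using F(2) W by (intro sum.cong refl sum_lookup_edge_element) auto
  finally have "(\<Sum>v\<in>W. D v - 2) = 2 * int (card F) - 2 * int (card W)"
    by (simp add: sum_subtractf)
  then have "(\<Sum>v\<in>W. D v - 2) \<le> 0" using \<open>card F \<le> card W\<close> by simp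
  moreover have "0 \<le> (\<Sum>v\<in>W. D v - 2)" using D2 by (intro sum_nonneg) simp
  ultimately have "(\<Sum>v\<in>W. D v - 2) = 0" by simp
  then have D: "D v = 2" if "v \<in> W" for v
    using that D2 W(1) by (subst (asm) sum_nonneg_eq_0_iff) auto
  \<comment> \<open>Positive weights below 1 at a vertex of degree 2 put the coefficient strictly
    between 0 and 2.\<close>
  have f1: "Poly_Mapping.lookup f v = (if v \<in> W then 1 else 0)" for v
  proof (cases "v \<in> W")
    case True
    then obtain a where a: "a \<in> F" "Poly_Mapping.lookup a v \<noteq> 0"
      by (auto simp: W_def in_keys_iff)
    then have pos: "0 < ?l a v" using nn[of a v] F(2) by force
    have l0: "0 \<le> ?l b v" if "b \<in> F" for b using that nn[of b v] F(2) by auto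
    have "?l f v < (\<Sum>b\<in>F. ?l b v)"
      unfolding fsum
    proof (rule sum_strict_mono_ex1[OF F(1)])
      show "\<forall>b\<in>F. c b * ?l b v \<le> ?l b v"
        using c1 l0 mult_right_mono[of "c _" 1] by fastforce
      show "\<exists>b\<in>F. c b * ?l b v < ?l b v"
        using a(1) pos c1[OF a(1)] by (intro bexI[of _ a]) auto
    qed
    also have "\<dots> = 2" using D[OF True] unfolding D_def by (metis of_int_numeral of_int_sum)
    finally have "Poly_Mapping.lookup f v < 2" by simp
    moreover have "0 < ?l f v"
      unfolding fsum
    proof (rule sum_pos2[OF F(1) a(1)])
      show "0 < c a * ?l a v" using c0[OF a(1)] pos by simp
      show "0 \<le> c b * ?l b v" if "b \<in> F" for b using c0[OF that] l0[OF that] by simp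
    qed
    ultimately show ?thesis using True by simp
  next
    case False
    then have "?l a v = 0" if "a \<in> F" for a using W(2)[OF that] by (auto simp: in_keys_iff)
    then have "?l f v = 0" unfolding fsum by (intro sum.neutral) simp
    with False show ?thesis by simp
  qed
  then have fW: "f = char_element W"
    using W(1) by (intro poly_mapping_eqI) (simp add: lookup_char_element)
  obtain P where P: "finite P" "\<forall>p\<in>P. cycle E p" "pairwise (\<lambda>p q. set p \<inter> set q = {}) P"
    "(\<Union>p\<in>P. set p) = W"
    using two_regular_cycle_decomposition[OF F W] D unfolding D_def by blast
  have "char_element W = (\<Sum>p\<in>P. char_element (set p))"
    unfolding char_element_def P(4)[symmetric]
    using P(1,3) by (intro sum.UNION_disjoint) (auto simp: pairwise_def)
  moreover have "W \<subseteq> V"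
    using fV(1) f1 by (auto simp: in_keys_iff subset_iff)
  ultimately show ?thesis
    using disjoint_cycles_in_hull[OF G P(1) _ P(3)] P(2,4) fV(2) fW by auto
qed

text \<open>Each edge split off lowers the sum of the coefficients by 2, and this sum stays
  nonnegative, so the splitting terminates.\<close>

lemma normal_monoid_subset_hull:
  assumes G: "finite_graph V E" and "f \<in> normal_monoid V E"
  shows "f \<in> add_submonoid hull (edge_elements E \<union> exceptional_elements E)"
  using assms(2)
proof (induction "nat (\<Sum>v\<in>V. Poly_Mapping.lookup f v)" arbitrary: f rule: less_induct)
  case less
  show ?case
  proof (cases "\<exists>a\<in>edge_elements E. f - a \<in> normal_monoid V E")
    case True
    then obtain a where a: "a \<in> edge_elements E" "f - a \<in> normal_monoid V E" by blast
    have "Poly_Mapping.keys a \<subseteq> V"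
      using edge_element_in_normal_monoid[OF G a(1)] by (simp add: normal_monoid_def)
    then have "(\<Sum>v\<in>V. Poly_Mapping.lookup a v) = 2"
      using G a(1) by (intro sum_lookup_edge_element) (simp_all add: finite_graph_def)
    moreover have "0 \<le> (\<Sum>v\<in>V. Poly_Mapping.lookup (f - a) v)"
      using normal_monoid_nonneg[OF a(2)] by (intro sum_nonneg)
    ultimately have "f - a \<in> add_submonoid hull (edge_elements E \<union> exceptional_elements E)"
      using a(2) by (intro less.hyps) (auto simp: lookup_minus sum_subtractf)
    then have "a + (f - a) \<in> add_submonoid hull (edge_elements E \<union> exceptional_elements E)"
      using a(1) by (intro hull_add) (simp_all add: hull_inc)
    then show ?thesis by simp
  next
    case False
    then show ?thesis using less.prems by (intro normal_monoid_reduced_in_hull[OF G]) auto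
  qed
qed

lemma zero_notin_generators: "0 \<notin> edge_elements E \<union> exceptional_elements E"
proof
  assume "0 \<in> edge_elements E \<union> exceptional_elements E"
  then show False
  proof
    assume "0 \<in> edge_elements E"
    then obtain x y :: 'a where "frag_of x + frag_of y = 0" by (auto simp: edge_elements_def)
    from arg_cong[OF this, of "\<lambda>f. Poly_Mapping.lookup f x"] show False
      by (simp add: lookup_add lookup_frag_of split: if_splits)
  next
    assume "0 \<in> exceptional_elements E"
    then obtain vs ws :: "'a list" where vw: "cycle E vs" "0 = char_element (set vs \<union> set ws)"
      by (elim exceptional_element_cases)
    from arg_cong[OF vw(2), of "\<lambda>f. Poly_Mapping.lookup f (hd vs)"] vw(1) show False
      by (simp add: lookup_char_element cycle_def)
  qed
qed

theorem theorem1: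
  fixes V :: "'a set" and E :: "'a set set"
  assumes "finite_graph V E"
  shows "minimal_generating_set (edge_elements E \<union> exceptional_elements E) (normal_monoid V E)
    \<and> (\<forall>S. minimal_generating_set S (normal_monoid V E) \<longrightarrow>
           S = edge_elements E \<union> exceptional_elements E)"
proof -
  have "edge_elements E \<union> exceptional_elements E \<subseteq> normal_monoid V E"
    using edge_element_in_normal_monoid[OF assms] exceptional_in_normal_monoid[OF assms] by blast
  then have "add_submonoid hull (edge_elements E \<union> exceptional_elements E) \<subseteq> normal_monoid V E"
    using add_submonoid_normal_monoid by (rule hull_minimal)
  then have gen: "generates (edge_elements E \<union> exceptional_elements E) (normal_monoid V E)"
    using normal_monoid_subset_hull[OF assms] unfolding generates_def by blast
  have irr: "\<forall>x\<in>edge_elements E \<union> exceptional_elements E.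
    \<forall>a\<in>normal_monoid V E. \<forall>b\<in>normal_monoid V E. x = a + b \<longrightarrow> a = 0 \<or> b = 0"
    using edge_element_irreducible[OF assms] exceptional_irreducible[OF assms] by blast
  show ?thesis
    using minimal_generating_set_unique[OF gen irr zero_notin_generators] by blast
qed

end
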